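(* Let $E$ be the infinite dimensional Grassmann algebra over a field $F$ of characteristic $0$ and let $k,l\in\mathbb{N}$. Then the double Hilbert series of $E$ is $$H(E;\mathrm{T}_k,\mathrm{Y}_l)=\frac12\left(1+\prod_{i=1}^k\frac{1+t_i}{1-t_i}\prod_{j=1}^l\frac{1+y_j}{1-y_j}\right).$$
   Context: Double Hilbert series. Let $\mathcal B=\{1\}\cup\{e_{i_1}\cdots e_{i_m}: i_1<\cdots<i_m,\ m\ge1\}$ be the standard basis of $E$, where $E$ is generated by $e_1,e_2,\dots$ with $e_ie_j=-e_je_i$; for $a=e_{i_1}\cdots e_{i_m}$ put $l(a)=m$ (and $l(1)=0$). For $I\subseteq\{1,\dots,n\}$ and $\sigma\in S_n$ choose $a_1,\dots,a_n\in\mathcal B$ with $a_1\cdots a_n\ne0$ and $\{i: l(a_i)\text{ odd}\}=I$, and define $f_I(\sigma)=\pm1$ by $a_{\sigma(1)}\cdots a_{\sigma(n)}=f_I(\sigma)a_1\cdots a_n$ (independent of the choice). Let $V$ be a vector space with basis $\{x_1,\dots,x_k,z_1,\dots,z_l\}$. $S_n$ acts on the right on $V^{\otimes n}$ by $$(v_1\otimes\cdots\otimes v_n)*\sigma=f_{J}(\sigma)\,v_{\sigma(1)}\otimes\cdots\otimes v_{\sigma(n)},\qquad J=\{i: v_i\in\{z_1,\dots,z_l\}\},$$ for basis elements $v_i$, extended linearly. Identify the space $P_n$ of multilinear polynomials in $x_1,\dots,x_n$ with $FS_n$ via $x_{\sigma(1)}\cdots x_{\sigma(n)}\leftrightarrow\sigma$,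 so $P_n$ acts on $V^{\otimes n}$ by $*$. For $a_1+\cdots+a_k+b_1+\cdots+b_l=n$ let $V\langle a;b\rangle\subseteq V^{\otimes n}$ be the subspace of elements homogeneous of degree $a_i$ in $x_i$ and $b_j$ in $z_j$. For a PI-algebra $A$ with ideal of identities $T(A)$ and $Q_n=T(A)\cap P_n$, with commuting variables $\mathrm{T}_k=\{t_1,\dots,t_k\}$, $\mathrm{Y}_l=\{y_1,\dots,y_l\}$, $$H(A;\mathrm{T}_k,\mathrm{Y}_l)=\sum_{\langle a;b\rangle}\dim_F\big(V\langle a;b\rangle/V\langle a;b\rangle*Q_n\big)\,t_1^{a_1}\cdots t_k^{a_k}y_1^{b_1}\cdots y_l^{b_l}.$$ *)

theory Defs
  imports
    Complex_Main
    "HOL-Library.Poly_Mapping"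
    "HOL-Combinatorics.Permutations"
begin

section \<open>The infinite dimensional Grassmann algebra\<close>

text \<open>
  An element is given by its coordinates with respect to the standard basis: the finite set
  \<open>S = {i\<^sub>1 < \<dots> < i\<^sub>m}\<close> stands for the basis element \<open>e\<^sub>i\<^sub>1 \<cdots> e\<^sub>i\<^sub>m\<close>
  (see \<open>gbasis_eq_prod\<close> below) and the empty set for \<open>1\<close>.
\<close>

typedef (overloaded) 'a grassmann =
  "{f :: nat set \<Rightarrow> 'a::zero. finite {S. f S \<noteq> 0} \<and> (\<forall>S. infinite S \<longrightarrow> f S = 0)}"
  morphisms gcoeff Abs_grassmann
  by (rule exI[of _ "\<lambda>_. 0"]) auto

setup_lifting type_definition_grassmann

text \<open>
  Moving the generators of \<open>T\<close> into place among those of \<open>S\<close> takes one transposition for each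
  pair \<open>t < s\<close>.
\<close>

definition gsign :: "nat set \<Rightarrow> nat set \<Rightarrow> 'a::comm_ring_1" where
  "gsign S T = (-1) ^ card {(s, t). s \<in> S \<and> t \<in> T \<and> t < s}"

lemma gsign_empty [simp]: "gsign {} T = 1" "gsign S {} = 1"
  by (simp_all add: gsign_def)

lemma gsign_Un_left:
  assumes "finite S" "finite T" "finite U" "S \<inter> T = {}"
  shows "gsign (S \<union> T) U = gsign S U * gsign T U"
proof -
  have e: "{(s, t). s \<in> S \<union> T \<and> t \<in> U \<and> t < s} =
     {(s, t). s \<in> S \<and> t \<in> U \<and> t < s} \<union> {(s, t). s \<in> T \<and> t \<in> U \<and> t < s}" by auto
  have f: "finite {(s, t). s \<in> S \<and> t \<in> U \<and> t < s}"
    by (rule finite_subset[of _ "S \<times> U"]) (use assms in auto)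
  have g: "finite {(s, t). s \<in> T \<and> t \<in> U \<and> t < s}"
    by (rule finite_subset[of _ "T \<times> U"]) (use assms in auto)
  show ?thesis unfolding gsign_def e
    by (subst card_Un_disjoint) (use assms f g in \<open>auto simp: power_add\<close>)
qed

lemma gsign_Un_right:
  assumes "finite S" "finite T" "finite U" "T \<inter> U = {}"
  shows "gsign S (T \<union> U) = gsign S T * gsign S U"
proof -
  have e: "{(s, t). s \<in> S \<and> t \<in> T \<union> U \<and> t < s} =
     {(s, t). s \<in> S \<and> t \<in> T \<and> t < s} \<union> {(s, t). s \<in> S \<and> t \<in> U \<and> t < s}" by auto
  have f: "finite {(s, t). s \<in> S \<and> t \<in> U \<and> t < s}"
    by (rule finite_subset[of _ "S \<times> U"]) (use assms in auto)
  have g: "finite {(s, t). s \<in> S \<and> t \<in> T \<and> t < s}"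
    by (rule finite_subset[of _ "S \<times> T"]) (use assms in auto)
  show ?thesis unfolding gsign_def e
    by (subst card_Un_disjoint) (use assms f g in \<open>auto simp: power_add\<close>)
qed

instantiation grassmann :: (comm_ring_1) ring_1
begin

lift_definition zero_grassmann :: "'a grassmann" is "\<lambda>_. 0" by auto

lift_definition one_grassmann :: "'a grassmann" is "\<lambda>S. if S = {} then 1 else 0"
  by auto

lift_definition plus_grassmann :: "'a grassmann \<Rightarrow> 'a grassmann \<Rightarrow> 'a grassmann"
  is "\<lambda>f g S. f S + g S"
proof -
  fix f g :: "nat set \<Rightarrow> 'a"
  assume "finite {S. f S \<noteq> 0} \<and> (\<forall>S. infinite S \<longrightarrow> f S = 0)"
    "finite {S. g S \<noteq> 0} \<and> (\<forall>S. infinite S \<longrightarrow> g S = 0)"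
  then show "finite {S. f S + g S \<noteq> 0} \<and> (\<forall>S. infinite S \<longrightarrow> f S + g S = 0)"
    by (auto intro: finite_subset[of _ "{S. f S \<noteq> 0} \<union> {S. g S \<noteq> 0}"])
qed

lift_definition uminus_grassmann :: "'a grassmann \<Rightarrow> 'a grassmann" is "\<lambda>f S. - f S" by simp

lift_definition minus_grassmann :: "'a grassmann \<Rightarrow> 'a grassmann \<Rightarrow> 'a grassmann"
  is "\<lambda>f g S. f S - g S"
proof -
  fix f g :: "nat set \<Rightarrow> 'a"
  assume "finite {S. f S \<noteq> 0} \<and> (\<forall>S. infinite S \<longrightarrow> f S = 0)"
    "finite {S. g S \<noteq> 0} \<and> (\<forall>S. infinite S \<longrightarrow> g S = 0)"
  then show "finite {S. f S - g S \<noteq> 0} \<and> (\<forall>S. infinite S \<longrightarrow> f S - g S = 0)"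
    by (auto intro: finite_subset[of _ "{S. f S \<noteq> 0} \<union> {S. g S \<noteq> 0}"])
qed

lift_definition times_grassmann :: "'a grassmann \<Rightarrow> 'a grassmann \<Rightarrow> 'a grassmann"
  is "\<lambda>f g U. \<Sum>S\<in>Pow U. gsign S (U - S) * f S * g (U - S)"
proof -
  fix f g :: "nat set \<Rightarrow> 'a"
  assume f: "finite {S. f S \<noteq> 0} \<and> (\<forall>S. infinite S \<longrightarrow> f S = 0)"
    and g: "finite {S. g S \<noteq> 0} \<and> (\<forall>S. infinite S \<longrightarrow> g S = 0)"
  have "{U. (\<Sum>S\<in>Pow U. gsign S (U - S) * f S * g (U - S)) \<noteq> 0} \<subseteq>
      (\<lambda>(S, T). S \<union> T) ` ({S. f S \<noteq> 0} \<times> {S. g S \<noteq> 0})"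
  proof
    fix U assume "U \<in> {U. (\<Sum>S\<in>Pow U. gsign S (U - S) * f S * g (U - S)) \<noteq> 0}"
    then have "(\<Sum>S\<in>Pow U. gsign S (U - S) * f S * g (U - S)) \<noteq> 0" by simp
    then obtain S where S: "S \<in> Pow U" "gsign S (U - S) * f S * g (U - S) \<noteq> 0"
      by (rule sum.not_neutral_contains_not_neutral)
    have "f S \<noteq> 0" "g (U - S) \<noteq> 0" "S \<union> (U - S) = U" using S by auto
    then show "U \<in> (\<lambda>(S, T). S \<union> T) ` ({S. f S \<noteq> 0} \<times> {S. g S \<noteq> 0})"
      by (intro image_eqI[of _ _ "(S, U - S)"]) auto
  qed
  with f g show "finite {U. (\<Sum>S\<in>Pow U. gsign S (U - S) * f S * g (U - S)) \<noteq> 0} \<and>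
      (\<forall>U. infinite U \<longrightarrow> (\<Sum>S\<in>Pow U. gsign S (U - S) * f S * g (U - S)) = 0)"
    by (auto elim!: finite_subset)
qed

instance
proof
  fix a b c :: "'a grassmann"
  show "a + b + c = a + (b + c)" by transfer (auto simp: add.assoc)
  show "a + b = b + a" by transfer (auto simp: add.commute)
  show "0 + a = a" by transfer auto
  show "- a + a = 0" by transfer auto
  show "a - b = a + - b" by transfer auto
  show "(0::'a grassmann) \<noteq> 1" by transfer (auto simp: fun_eq_iff)
  show "(a + b) * c = a * c + b * c"
    by transfer (auto simp: algebra_simps sum.distrib)
  show "a * (b + c) = a * b + a * c"
    by transfer (auto simp: algebra_simps sum.distrib)
  show "1 * a = a"
  proof transfer
    fix f :: "nat set \<Rightarrow> 'a"
    assume f: "finite {S. f S \<noteq> 0} \<and> (\<forall>S. infinite S \<longrightarrow> f S = 0)"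
    show "(\<lambda>U. \<Sum>S\<in>Pow U. gsign S (U - S) * (if S = {} then 1 else 0) * f (U - S)) = f"
    proof
      fix U
      show "(\<Sum>S\<in>Pow U. gsign S (U - S) * (if S = {} then 1 else 0) * f (U - S)) = f U"
      proof (cases "finite U")
        case True
        have "(\<Sum>S\<in>Pow U. gsign S (U - S) * (if S = {} then 1 else 0) * f (U - S)) =
          (\<Sum>S\<in>Pow U. if S = {} then f U else 0)"
          by (rule sum.cong) auto
        with True show ?thesis by simp
      qed (use f in auto)
    qed
  qed
  show "a * 1 = a"
  proof transfer
    fix f :: "nat set \<Rightarrow> 'a"
    assume f: "finite {S. f S \<noteq> 0} \<and> (\<forall>S. infinite S \<longrightarrow> f S = 0)"
    show "(\<lambda>U. \<Sum>S\<in>Pow U. gsign S (U - S) * f S * (if U - S = {} then 1 else 0)) = f"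
    proof
      fix U
      show "(\<Sum>S\<in>Pow U. gsign S (U - S) * f S * (if U - S = {} then 1 else 0)) = f U"
      proof (cases "finite U")
        case True
        have "(\<Sum>S\<in>Pow U. gsign S (U - S) * f S * (if U - S = {} then 1 else 0)) =
          (\<Sum>S\<in>Pow U. if S = U then f U else 0)"
          by (rule sum.cong) auto
        with True show ?thesis by simp
      qed (use f in auto)
    qed
  qed
  show "a * b * c = a * (b * c)"
  proof transfer
    fix f g h :: "nat set \<Rightarrow> 'a"
    assume h: "finite {S. h S \<noteq> 0} \<and> (\<forall>S. infinite S \<longrightarrow> h S = 0)"
    have "(\<Sum>R\<in>Pow U. gsign R (U - R) *
            (\<Sum>S\<in>Pow R. gsign S (R - S) * f S * g (R - S)) * h (U - R)) =
          (\<Sum>S\<in>Pow U. gsign S (U - S) * f S *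
            (\<Sum>T\<in>Pow (U - S). gsign T (U - S - T) * g T * h (U - S - T)))" (is "?L = ?R")
      if U: "finite U" for U
    proof -
      define G where "G R S = gsign R (U - R) * gsign S (R - S) * (f S * g (R - S) * h (U - R))"
        for R S
      define G' where
        "G' S T = gsign S (U - S) * gsign T (U - S - T) * (f S * g T * h (U - S - T))" for S T
      have key: "G R S = G' S (R - S)" if RS: "R \<subseteq> U" "S \<subseteq> R" for R S
      proof -
        have fin: "finite R" "finite S" using U RS by (auto intro: finite_subset)
        have d: "U - S - (R - S) = U - R" "R = S \<union> (R - S)" "U - S = (R - S) \<union> (U - R)"
          using RS by auto
        have "gsign R (U - R) = (gsign S (U - R) * gsign (R - S) (U - R) :: 'a)"
          by (subst d(2), rule gsign_Un_left) (use fin U in auto)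
        moreover have "gsign S (U - S) = (gsign S (R - S) * gsign S (U - R) :: 'a)"
          by (subst d(3), rule gsign_Un_right) (use fin U in auto)
        ultimately show ?thesis by (simp add: G_def G'_def d(1) mult_ac)
      qed
      have "?L = (\<Sum>R\<in>Pow U. \<Sum>S\<in>Pow R. G R S)"
        by (simp add: G_def sum_distrib_left sum_distrib_right mult_ac)
      also have "\<dots> = (\<Sum>(R, S)\<in>Sigma (Pow U) Pow. G R S)"
        using U by (subst sum.Sigma) (auto intro: finite_subset)
      also have "\<dots> = (\<Sum>(S, T)\<in>Sigma (Pow U) (\<lambda>S. Pow (U - S)). G' S T)"
        by (rule sum.reindex_bij_witness[where i = "\<lambda>(S, T). (S \<union> T, S)"
              and j = "\<lambda>(R, S). (S, R - S)"]) (auto simp: key)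
      also have "\<dots> = (\<Sum>S\<in>Pow U. \<Sum>T\<in>Pow (U - S). G' S T)"
        using U by (subst sum.Sigma) auto
      also have "\<dots> = ?R" by (simp add: G'_def sum_distrib_left mult_ac)
      finally show ?thesis .
    qed
    then show "(\<lambda>U. \<Sum>R\<in>Pow U. gsign R (U - R) *
            (\<Sum>S\<in>Pow R. gsign S (R - S) * f S * g (R - S)) * h (U - R)) =
          (\<lambda>U. \<Sum>S\<in>Pow U. gsign S (U - S) * f S *
            (\<Sum>T\<in>Pow (U - S). gsign T (U - S - T) * g T * h (U - S - T)))"
      by (intro ext, case_tac "finite U") auto
  qed
qed

end

lift_definition gscale :: "'a::comm_ring_1 \<Rightarrow> 'a grassmann \<Rightarrow> 'a grassmann"
  is "\<lambda>c f S. c * f S"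
proof -
  fix c and f :: "nat set \<Rightarrow> 'a"
  assume "finite {S. f S \<noteq> 0} \<and> (\<forall>S. infinite S \<longrightarrow> f S = 0)"
  then show "finite {S. c * f S \<noteq> 0} \<and> (\<forall>S. infinite S \<longrightarrow> c * f S = 0)"
    by (auto intro: finite_subset[of _ "{S. f S \<noteq> 0}"])
qed

lemma gscale_one [simp]: "gscale 1 a = a"
  by transfer simp

lemma gscale_mult:
  "gscale c a * b = gscale c (a * b)" "a * gscale c b = gscale c (a * b)"
  by (transfer, simp add: sum_distrib_left mult_ac)+

global_interpretation grassmann: vector_space "gscale :: 'a::field \<Rightarrow> _"
  by unfold_locales (transfer, auto simp: algebra_simps)+

lift_definition gbasis :: "nat set \<Rightarrow> 'a::comm_ring_1 grassmann"
  is "\<lambda>S U. if finite S \<and> U = S then 1 else 0"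
  by auto

definition ggen :: "nat \<Rightarrow> 'a::comm_ring_1 grassmann" where
  "ggen i = gbasis {i}"

lemma gbasis_mult:
  assumes "finite S" "finite T"
  shows "gbasis S * gbasis T =
    (if S \<inter> T = {} then gscale (gsign S T) (gbasis (S \<union> T)) else 0)"
proof -
  have "(\<Sum>R\<in>Pow U. gsign R (U - R) * (if R = S then 1 else 0) * (if U - R = T then 1 else 0)) =
     (if S \<inter> T = {} \<and> U = S \<union> T then gsign S T else (0::'a))" for U :: "nat set"
  proof (cases "finite U")
    case True
    have "(\<Sum>R\<in>Pow U. gsign R (U - R) * (if R = S then 1 else 0) * (if U - R = T then 1 else 0)) =
      (\<Sum>R\<in>Pow U. if R = S then (if U - S = T then gsign S T else 0) else (0::'a))"
      by (rule sum.cong) auto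
    also have "\<dots> = (if S \<inter> T = {} \<and> U = S \<union> T then gsign S T else 0)"
      using True by (auto simp: Int_absorb2 intro: sum.neutral)
    finally show ?thesis .
  qed (use assms in auto)
  then show ?thesis using assms
    by (transfer) (auto simp: fun_eq_iff)
qed

lemma ggen_anticommute: "ggen i * ggen j = - (ggen j * ggen i :: 'a::comm_ring_1 grassmann)"
proof -
  have *: "{(s, t). s = i \<and> t = j \<and> t < s} = (if j < i then {(i, j)} else {})" for i j :: nat
    by auto
  consider "i < j" | "j < i" | "i = j" by linarith
  then show ?thesis
    by cases (simp_all add: ggen_def gbasis_mult gsign_def * insert_commute, (transfer, auto)+)
qed

lemma gbasis_eq_prod:
  assumes "finite S"
  shows "gbasis S = prod_list (map ggen (sorted_list_of_set S))"
  using assms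
proof (induction "card S" arbitrary: S)
  case 0
  then show ?case by simp (transfer, auto)
next
  case (Suc n)
  let ?m = "Min S"
  from Suc have "S \<noteq> {}" by auto
  then have m: "?m \<in> S" "\<And>x. x \<in> S \<Longrightarrow> ?m \<le> x" using Suc by auto
  have "{(s, t). s \<in> {?m} \<and> t \<in> S - {?m} \<and> t < s} = {}" using m by force
  then have sg: "gsign {?m} (S - {?m}) = (1::'a)" unfolding gsign_def by (simp only: card.empty power_0)
  have "gbasis S = ggen ?m * (gbasis (S - {?m}) :: 'a grassmann)"
    unfolding ggen_def using Suc.prems m(1)
    by (subst gbasis_mult) (auto simp: sg insert_absorb gscale_one)
  also have "gbasis (S - {?m}) = (prod_list (map ggen (sorted_list_of_set (S - {?m}))) :: 'a grassmann)"
    by (rule Suc.hyps) (use Suc m in auto)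
  finally show ?case using Suc.prems \<open>S \<noteq> {}\<close>
    by (simp add: sorted_list_of_set_nonempty)
qed


section \<open>Sign permutations\<close>

text \<open>
  Positions are numbered \<open>0, \<dots>, n - 1\<close> throughout, and the symmetric group on \<open>n\<close> letters
  consists of the \<open>\<sigma>\<close> with \<open>\<sigma> permutes {..<n}\<close>. The family \<open>a\<close> lists the
  index sets of \<open>n\<close> standard basis elements, whose lengths are the cardinalities of these sets.
\<close>

definition gadmissible :: "'f::field itself \<Rightarrow> nat \<Rightarrow> nat set \<Rightarrow> (nat \<Rightarrow> nat set) \<Rightarrow> bool" where
  "gadmissible _ n I a \<longleftrightarrow>
     (\<forall>i<n. finite (a i)) \<and>
     prod_list (map (\<lambda>i. gbasis (a i)) [0..<n]) \<noteq> (0 :: 'f grassmann) \<and>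
     {i. i < n \<and> odd (card (a i))} = I"

definition fsign :: "nat \<Rightarrow> nat set \<Rightarrow> (nat \<Rightarrow> nat) \<Rightarrow> 'f::field" where
  "fsign n I \<sigma> = (THE s. (s = 1 \<or> s = -1) \<and>
     (\<forall>a. gadmissible TYPE('f) n I a \<longrightarrow>
        prod_list (map (\<lambda>i. gbasis (a (\<sigma> i))) [0..<n]) =
        gscale s (prod_list (map (\<lambda>i. gbasis (a i)) [0..<n]))))"


section \<open>Free vector spaces and dimensions of quotients\<close>

text \<open>
  The vector space with basis \<open>'w\<close> is the type \<open>'w \<Rightarrow>\<^sub>0 'f\<close> of finitely supported functions.
\<close>

definition pscale :: "'f::field \<Rightarrow> ('w \<Rightarrow>\<^sub>0 'f) \<Rightarrow> ('w \<Rightarrow>\<^sub>0 'f)" where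
  "pscale c p = Poly_Mapping.map ((*) c) p"

lemma lookup_pscale [simp]: "Poly_Mapping.lookup (pscale c p) w = c * Poly_Mapping.lookup p w"
  by (simp add: pscale_def map.rep_eq when_def)

global_interpretation pm: vector_space "pscale :: 'f::field \<Rightarrow> ('w \<Rightarrow>\<^sub>0 'f) \<Rightarrow> _"
  by unfold_locales (auto intro!: poly_mapping_eqI simp: lookup_add algebra_simps)

text \<open>The elements of \<open>B\<close> represent, without repetition, a basis of \<open>V / W\<close>.\<close>

definition quotient_basis ::
  "('w \<Rightarrow>\<^sub>0 'f::field) set \<Rightarrow> ('w \<Rightarrow>\<^sub>0 'f) set \<Rightarrow> ('w \<Rightarrow>\<^sub>0 'f) set \<Rightarrow> bool" where
  "quotient_basis V W B \<longleftrightarrow>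
     B \<subseteq> V \<and>
     (\<forall>S c. finite S \<and> S \<subseteq> B \<and> (\<Sum>b\<in>S. pscale (c b) b) \<in> W \<longrightarrow> (\<forall>b\<in>S. c b = 0)) \<and>
     (\<forall>v\<in>V. \<exists>u\<in>pm.span B. v - u \<in> W)"

definition quotient_dim :: "('w \<Rightarrow>\<^sub>0 'f::field) set \<Rightarrow> ('w \<Rightarrow>\<^sub>0 'f) set \<Rightarrow> nat" where
  "quotient_dim V W = card (SOME B. quotient_basis V W B)"

lemma quotient_basis_card:
  assumes V: "pm.subspace V" and W: "pm.subspace W" "W \<subseteq> V"
    and F: "finite F" "V \<subseteq> pm.span F" and B: "quotient_basis V W B"
  shows "card B + pm.dim W = pm.dim V"
proof -
  obtain C where C: "C \<subseteq> W" "pm.independent C" "W \<subseteq> pm.span C" "card C = pm.dim W"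
    by (rule pm.basis_exists[of W])
  have finC: "finite C"
    using pm.independent_span_bound[OF F(1) C(2)] C(1) W(2) F(2) by blast
  note BV = B[unfolded quotient_basis_def, THEN conjunct1]
  note ind = B[unfolded quotient_basis_def, THEN conjunct2, THEN conjunct1, rule_format]
  note gen = B[unfolded quotient_basis_def, THEN conjunct2, THEN conjunct2, rule_format]
  have spC: "pm.span C = W"
    using C(1,3) W(1) pm.span_minimal by blast
  have disj: "B \<inter> C = {}"
  proof (rule ccontr)
    assume "B \<inter> C \<noteq> {}"
    then obtain b where "b \<in> B" "b \<in> C" by auto
    then show False using ind[of "{b}" "\<lambda>_. 1" b] C(1) by auto
  qed
  have "pm.independent (B \<union> C)"
  proof
    assume "pm.dependent (B \<union> C)"
    then obtain S c where S: "finite S" "S \<subseteq> B \<union> C" "(\<Sum>v\<in>S. pscale (c v) v) = 0" "\<exists>v\<in>S. c v \<noteq> 0"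
      unfolding pm.dependent_explicit by blast
    have "S = (S \<inter> B) \<union> (S \<inter> C)" using S(2) by blast
    then have "(\<Sum>v\<in>S. pscale (c v) v) = (\<Sum>v\<in>(S \<inter> B) \<union> (S \<inter> C). pscale (c v) v)"
      by (rule arg_cong)
    also have "\<dots> = (\<Sum>v\<in>S \<inter> B. pscale (c v) v) + (\<Sum>v\<in>S \<inter> C. pscale (c v) v)"
      by (rule sum.union_disjoint) (use S(1) disj in blast)+
    finally have split: "(\<Sum>v\<in>S. pscale (c v) v) =
        (\<Sum>v\<in>S \<inter> B. pscale (c v) v) + (\<Sum>v\<in>S \<inter> C. pscale (c v) v)" .
    have WC: "(\<Sum>v\<in>S \<inter> C. pscale (c v) v) \<in> W"
      using C(1) by (intro pm.subspace_sum[OF W(1)] pm.subspace_scale[OF W(1)]) auto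
    have "(\<Sum>v\<in>S \<inter> B. pscale (c v) v) = - (\<Sum>v\<in>S \<inter> C. pscale (c v) v)"
      using S(3) split by (simp add: eq_neg_iff_add_eq_0)
    then have "(\<Sum>v\<in>S \<inter> B. pscale (c v) v) \<in> W"
      using pm.subspace_neg[OF W(1) WC] by simp
    then have b0: "c v = 0" if "v \<in> S \<inter> B" for v
      using ind[of "S \<inter> B" c v] that S(1) by auto
    then have "(\<Sum>v\<in>S \<inter> B. pscale (c v) v) = 0"
      by (intro sum.neutral) auto
    then have "(\<Sum>v\<in>S \<inter> C. pscale (c v) v) = 0" using S(3) split by simp
    then have "c v = 0" if "v \<in> S \<inter> C" for v
      using C(2) that S(1) unfolding pm.independent_explicit_module by blast
    with b0 S show False by blast
  qed
  moreover have "V \<subseteq> pm.span (B \<union> C)"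
  proof
    fix v assume "v \<in> V"
    then obtain u where u: "u \<in> pm.span B" "v - u \<in> W" using gen by blast
    have "u \<in> pm.span (B \<union> C)" using u(1) pm.span_mono[of B "B \<union> C"] by blast
    moreover have "v - u \<in> pm.span (B \<union> C)" using u(2) spC pm.span_mono[of C "B \<union> C"] by blast
    ultimately have "u + (v - u) \<in> pm.span (B \<union> C)" by (rule pm.span_add)
    then show "v \<in> pm.span (B \<union> C)" by simp
  qed
  moreover have BC: "B \<union> C \<subseteq> V" using BV C(1) W(2) by blast
  ultimately have "card (B \<union> C) = pm.dim V" by (intro pm.basis_card_eq_dim)
  moreover have "finite (B \<union> C)"
    using pm.independent_span_bound[OF F(1) \<open>pm.independent (B \<union> C)\<close>] BC F(2) by blast
  ultimately show ?thesis
    using disj C(4) by (simp add: card_Un_disjoint)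
qed

lemma quotient_basis_exists:
  assumes V: "pm.subspace V" and W: "pm.subspace W" "W \<subseteq> V"
  shows "\<exists>B. quotient_basis V W B"
proof -
  obtain C where C: "C \<subseteq> W" "pm.independent C" "W \<subseteq> pm.span C"
    by (rule pm.basis_exists[of W])
  obtain D where D: "C \<subseteq> D" "D \<subseteq> V" "pm.independent D" "V \<subseteq> pm.span D"
    by (rule pm.maximal_independent_subset_extend[OF order_trans[OF C(1) W(2)] C(2)])
  have spC: "pm.span C = W"
    using C(1,3) W(1) pm.span_minimal by blast
  have "quotient_basis V W (D - C)"
    unfolding quotient_basis_def
  proof (intro conjI allI impI ballI)
    show "D - C \<subseteq> V" using D by blast
  next
    fix S c b assume S: "finite S \<and> S \<subseteq> D - C \<and> (\<Sum>b\<in>S. pscale (c b) b) \<in> W" and b: "b \<in> S"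
    then have "(\<Sum>b\<in>S. pscale (c b) b) \<in> pm.span C" by (simp add: spC)
    then obtain t r where t: "finite t" "t \<subseteq> C"
      "(\<Sum>b\<in>S. pscale (c b) b) = (\<Sum>a\<in>t. pscale (r a) a)"
      unfolding pm.span_explicit by blast
    define d where "d v = (if v \<in> S then c v else - r v)" for v
    have dj: "S \<inter> t = {}" using S t by blast
    have "(\<Sum>v\<in>S \<union> t. pscale (d v) v) = (\<Sum>v\<in>S. pscale (d v) v) + (\<Sum>v\<in>t. pscale (d v) v)"
      by (rule sum.union_disjoint) (use S t(1) dj in blast)+
    also have "(\<Sum>v\<in>S. pscale (d v) v) = (\<Sum>v\<in>S. pscale (c v) v)"
      by (intro sum.cong) (auto simp: d_def)
    also have "(\<Sum>v\<in>t. pscale (d v) v) = (\<Sum>v\<in>t. - pscale (r v) v)"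
      using dj by (intro sum.cong) (auto simp: d_def)
    finally have "(\<Sum>v\<in>S \<union> t. pscale (d v) v) = 0" by (simp add: t(3) sum_negf)
    moreover have "finite (S \<union> t)" "S \<union> t \<subseteq> D" "b \<in> S \<union> t" using D(1) S t(1,2) b by blast+
    ultimately have "d b = 0"
      by (intro D(3)[unfolded pm.independent_explicit_module, rule_format])
    then show "c b = 0" using b by (simp add: d_def)
  next
    fix v assume "v \<in> V"
    then have "v \<in> pm.span ((D - C) \<union> C)" using D(1,4) by (auto simp: Un_absorb2)
    then obtain x y where "v = x + y" "x \<in> pm.span (D - C)" "y \<in> pm.span C"
      unfolding pm.span_Un by auto
    then show "\<exists>u\<in>pm.span (D - C). v - u \<in> W" using spC by auto
  qed
  then show ?thesis by blast
qed

lemma quotient_dim: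
  assumes "pm.subspace V" "pm.subspace W" "W \<subseteq> V" "finite F" "V \<subseteq> pm.span F"
  shows "quotient_dim V W + pm.dim W = pm.dim V"
  unfolding quotient_dim_def
  by (rule quotient_basis_card[OF assms someI_ex[OF quotient_basis_exists[OF assms(1-3)]]])


section \<open>Polynomial identities\<close>

text \<open>
  A word \<open>[i\<^sub>1, \<dots>, i\<^sub>m]\<close> stands for the noncommutative monomial \<open>x\<^sub>i\<^sub>1 \<cdots> x\<^sub>i\<^sub>m\<close>, so
  \<open>nat list \<Rightarrow>\<^sub>0 'f\<close> is the space of the free unital algebra. An algebra is a ring
  together with its scalar multiplication.
\<close>

definition eval_poly ::
  "('f::field \<Rightarrow> 'a::ring_1 \<Rightarrow> 'a) \<Rightarrow> (nat \<Rightarrow> 'a) \<Rightarrow> (nat list \<Rightarrow>\<^sub>0 'f) \<Rightarrow> 'a" where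
  "eval_poly scl a q =
     (\<Sum>w\<in>Poly_Mapping.keys q. scl (Poly_Mapping.lookup q w) (prod_list (map a w)))"

definition identities :: "('f::field \<Rightarrow> 'a::ring_1 \<Rightarrow> 'a) \<Rightarrow> (nat list \<Rightarrow>\<^sub>0 'f) set" where
  "identities scl = {q. \<forall>a. eval_poly scl a q = 0}"

definition multilinear_polys :: "nat \<Rightarrow> (nat list \<Rightarrow>\<^sub>0 'f::field) set" where
  "multilinear_polys n =
     {q. \<forall>w\<in>Poly_Mapping.keys q. \<exists>\<sigma>. \<sigma> permutes {..<n} \<and> w = map \<sigma> [0..<n]}"

definition multilinear_identities ::
  "('f::field \<Rightarrow> 'a::ring_1 \<Rightarrow> 'a) \<Rightarrow> nat \<Rightarrow> (nat list \<Rightarrow>\<^sub>0 'f) set" where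
  "multilinear_identities scl n = identities scl \<inter> multilinear_polys n"


section \<open>The signed action on tensor powers\<close>

text \<open>
  \<open>V\<close> has the basis \<open>X i\<close> (\<open>i < k\<close>), \<open>Z j\<close> (\<open>j < l\<close>). Its \<open>n\<close>-th tensor power is
  the space spanned by the words of length \<open>n\<close>, the word \<open>[v\<^sub>1, \<dots>, v\<^sub>n]\<close> standing
  for the tensor \<open>v\<^sub>1 \<otimes> \<dots> \<otimes> v\<^sub>n\<close>.
\<close>

datatype gen = X nat | Z nat

definition gens :: "nat \<Rightarrow> nat \<Rightarrow> gen set" where
  "gens k l = X ` {..<k} \<union> Z ` {..<l}"

definition tensor_power :: "nat \<Rightarrow> nat \<Rightarrow> nat \<Rightarrow> (gen list \<Rightarrow>\<^sub>0 'f::field) set" where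
  "tensor_power k l n = {p. \<forall>w\<in>Poly_Mapping.keys p. length w = n \<and> set w \<subseteq> gens k l}"

definition homogeneous_part ::
  "nat \<Rightarrow> nat \<Rightarrow> (nat \<Rightarrow> nat) \<Rightarrow> (nat \<Rightarrow> nat) \<Rightarrow> (gen list \<Rightarrow>\<^sub>0 'f::field) set" where
  "homogeneous_part k l a b =
     {p \<in> tensor_power k l ((\<Sum>i<k. a i) + (\<Sum>j<l. b j)).
        \<forall>w\<in>Poly_Mapping.keys p.
          (\<forall>i<k. count_list w (X i) = a i) \<and> (\<forall>j<l. count_list w (Z j) = b j)}"

definition perm_act ::
  "nat \<Rightarrow> (gen list \<Rightarrow>\<^sub>0 'f::field) \<Rightarrow> (nat \<Rightarrow> nat) \<Rightarrow> (gen list \<Rightarrow>\<^sub>0 'f)" where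
  "perm_act n p \<sigma> =
     (\<Sum>w\<in>Poly_Mapping.keys p. Poly_Mapping.single (map (\<lambda>i. w ! \<sigma> i) [0..<n])
        (Poly_Mapping.lookup p w * fsign n {i. i < n \<and> w ! i \<in> range Z} \<sigma>))"

definition poly_act ::
  "nat \<Rightarrow> (gen list \<Rightarrow>\<^sub>0 'f::field) \<Rightarrow> (nat list \<Rightarrow>\<^sub>0 'f) \<Rightarrow> (gen list \<Rightarrow>\<^sub>0 'f)" where
  "poly_act n p q =
     (\<Sum>\<sigma> | \<sigma> permutes {..<n}.
        pscale (Poly_Mapping.lookup q (map \<sigma> [0..<n])) (perm_act n p \<sigma>))"

definition homogeneous_dim ::
  "('f::field \<Rightarrow> 'a::ring_1 \<Rightarrow> 'a) \<Rightarrow> nat \<Rightarrow> nat \<Rightarrow> (nat \<Rightarrow> nat) \<Rightarrow> (nat \<Rightarrow> nat) \<Rightarrow> nat" where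
  "homogeneous_dim scl k l a b =
     (let n = (\<Sum>i<k. a i) + (\<Sum>j<l. b j);
          V = homogeneous_part k l a b;
          Q = multilinear_identities scl n
      in quotient_dim V (pm.span {poly_act n v q | v q. v \<in> V \<and> q \<in> Q}))"


section \<open>Multivariate formal power series\<close>

text \<open>A series is the family of its coefficients, indexed by exponent vectors \<open>'v \<Rightarrow>\<^sub>0 nat\<close>.\<close>

typedef ('v, 'a) mfps = "UNIV :: (('v \<Rightarrow>\<^sub>0 nat) \<Rightarrow> 'a) set"
  morphisms mfps_coeff Abs_mfps
  by simp

setup_lifting type_definition_mfps

lemma finite_exponent_splits: "finite {(p, q). p + q = (m :: 'v \<Rightarrow>\<^sub>0 nat)}"
proof -
  let ?N = "Max (insert 0 (Poly_Mapping.lookup m ` Poly_Mapping.keys m))"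
  let ?F = "{f. \<forall>x. (x \<in> Poly_Mapping.keys m \<longrightarrow> f x \<in> {..?N}) \<and>
    (x \<notin> Poly_Mapping.keys m \<longrightarrow> f x = (0::nat))}"
  have fin: "finite ?F"
    by (rule finite_set_of_finite_funs) auto
  have le: "Poly_Mapping.lookup m x \<le> ?N" if "x \<in> Poly_Mapping.keys m" for x
    using that by (intro Max_ge) auto
  have "{p. \<exists>q. p + q = m} \<subseteq> Abs_poly_mapping ` ?F"
  proof
    fix p assume "p \<in> {p. \<exists>q. p + q = m}"
    then obtain q where q: "m = p + q" by auto
    have pm: "Poly_Mapping.lookup p x \<le> Poly_Mapping.lookup m x" for x
      by (simp add: q lookup_add)
    have "Poly_Mapping.lookup p x \<in> {..?N}" if "x \<in> Poly_Mapping.keys m" for x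
      unfolding atMost_iff by (rule order_trans[OF pm le[OF that]])
    moreover have "Poly_Mapping.lookup p x = 0" if "x \<notin> Poly_Mapping.keys m" for x
      using pm[of x] that by (simp add: in_keys_iff)
    ultimately have "Poly_Mapping.lookup p \<in> ?F" by blast
    then show "p \<in> Abs_poly_mapping ` ?F"
      by (intro image_eqI[of _ _ "Poly_Mapping.lookup p"]) (simp_all only: lookup_inverse)
  qed
  then have 1: "finite {p. \<exists>q. p + q = m}" using fin finite_subset by blast
  have "{(p, q). p + q = m} \<subseteq> (\<lambda>p. (p, m - p)) ` {p. \<exists>q. p + q = m}" by force
  then show ?thesis by (rule finite_subset) (use 1 in simp)
qed

instantiation mfps :: (type, comm_ring_1) comm_ring_1
begin

lift_definition zero_mfps :: "('a, 'b) mfps" is "\<lambda>_. 0" .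
lift_definition one_mfps :: "('a, 'b) mfps" is "\<lambda>m. if m = 0 then 1 else 0" .
lift_definition plus_mfps :: "('a, 'b) mfps \<Rightarrow> ('a, 'b) mfps \<Rightarrow> ('a, 'b) mfps"
  is "\<lambda>f g m. f m + g m" .
lift_definition minus_mfps :: "('a, 'b) mfps \<Rightarrow> ('a, 'b) mfps \<Rightarrow> ('a, 'b) mfps"
  is "\<lambda>f g m. f m - g m" .
lift_definition uminus_mfps :: "('a, 'b) mfps \<Rightarrow> ('a, 'b) mfps" is "\<lambda>f m. - f m" .
lift_definition times_mfps :: "('a, 'b) mfps \<Rightarrow> ('a, 'b) mfps \<Rightarrow> ('a, 'b) mfps"
  is "\<lambda>f g m. \<Sum>(p, q) | p + q = m. f p * g q" .

instance
proof
  fix a b c :: "('a, 'b) mfps"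
  show "a + b + c = a + (b + c)" by transfer (auto simp: add.assoc)
  show "a + b = b + a" by transfer (auto simp: add.commute)
  show "0 + a = a" by transfer auto
  show "- a + a = 0" by transfer auto
  show "a - b = a + - b" by transfer auto
  show "(0::('a, 'b) mfps) \<noteq> 1" by transfer (auto simp: fun_eq_iff)
  show "(a + b) * c = a * c + b * c"
    by transfer (auto simp: algebra_simps sum.distrib case_prod_unfold)
  show "a * b = b * a"
  proof transfer
    fix f g :: "('a \<Rightarrow>\<^sub>0 nat) \<Rightarrow> 'b"
    have "(\<Sum>(p, q) | p + q = m. f p * g q) = (\<Sum>(p, q) | p + q = m. g p * f q)" for m
      by (rule sum.reindex_bij_witness[where i = "\<lambda>(p, q). (q, p)" and j = "\<lambda>(p, q). (q, p)"])
        (auto simp: mult.commute add.commute)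
    then show "(\<lambda>m. \<Sum>(p, q) | p + q = m. f p * g q) = (\<lambda>m. \<Sum>(p, q) | p + q = m. g p * f q)"
      by blast
  qed
  show "1 * a = a"
  proof transfer
    fix f :: "('a \<Rightarrow>\<^sub>0 nat) \<Rightarrow> 'b"
    have "(\<Sum>(p, q) | p + q = m. (if p = 0 then 1 else 0) * f q) = f m" for m
    proof -
      have "(\<Sum>(p, q) | p + q = m. (if p = 0 then 1 else 0) * f q) =
        (\<Sum>pq | fst pq + snd pq = m. if pq = (0, m) then f m else 0)"
        by (rule sum.cong) (auto split: if_splits)
      also have "\<dots> = f m"
        using finite_exponent_splits[of m] by (simp add: case_prod_unfold)
      finally show ?thesis .
    qed
    then show "(\<lambda>m. \<Sum>(p, q) | p + q = m. (if p = 0 then 1 else 0) * f q) = f" by blast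
  qed
  show "a * b * c = a * (b * c)"
  proof transfer
    fix f g h :: "('a \<Rightarrow>\<^sub>0 nat) \<Rightarrow> 'b"
    note fin = finite_exponent_splits
    have "(\<Sum>(r, q) | r + q = m. (\<Sum>(s, t) | s + t = r. f s * g t) * h q) =
        (\<Sum>(s, r) | s + r = m. f s * (\<Sum>(t, q) | t + q = r. g t * h q))" (is "?L = ?R") for m
    proof -
      have "?L = (\<Sum>x | fst x + snd x = m. \<Sum>y | fst y + snd y = fst x.
          f (fst y) * g (snd y) * h (snd x))"
        by (simp add: case_prod_unfold sum_distrib_right)
      also have "\<dots> = (\<Sum>(x, y)\<in>Sigma {x. fst x + snd x = m} (\<lambda>x. {y. fst y + snd y = fst x}).
          f (fst y) * g (snd y) * h (snd x))"
        using fin by (subst sum.Sigma) (auto simp: case_prod_unfold)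
      also have "\<dots> = (\<Sum>(x, y)\<in>Sigma {x. fst x + snd x = m} (\<lambda>x. {y. fst y + snd y = snd x}).
          f (fst x) * g (fst y) * h (snd y))"
        by (rule sum.reindex_bij_witness
            [where j = "\<lambda>(x, y). ((fst y, snd y + snd x), (snd y, snd x))"
              and i = "\<lambda>(x, y). ((fst x + fst y, snd y), (fst x, fst y))"])
          (auto simp: add.assoc)
      also have "\<dots> = (\<Sum>x | fst x + snd x = m. \<Sum>y | fst y + snd y = snd x.
          f (fst x) * g (fst y) * h (snd y))"
        using fin by (subst sum.Sigma) (auto simp: case_prod_unfold)
      also have "\<dots> = ?R"
        by (simp add: case_prod_unfold sum_distrib_left mult.assoc)
      finally show ?thesis .
    qed
    then show "(\<lambda>m. \<Sum>(r, q) | r + q = m. (\<Sum>(s, t) | s + t = r. f s * g t) * h q) =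
        (\<lambda>m. \<Sum>(s, r) | s + r = m. f s * (\<Sum>(t, q) | t + q = r. g t * h q))" by blast
  qed
qed

end

text \<open>The inverse of a non-unit is \<open>0\<close>, as for univariate formal power series.\<close>

instantiation mfps :: (type, comm_ring_1) inverse
begin

definition inverse_mfps_def:
  "inverse (f :: ('a, 'b) mfps) = (if \<exists>g. f * g = 1 then THE g. f * g = 1 else 0)"

definition divide_mfps_def:
  "(f :: ('a, 'b) mfps) div g = f * inverse g"

instance ..

end

lemma inverse_mfps_unique:
  assumes "f * g = (1 :: ('v, 'a::comm_ring_1) mfps)"
  shows "inverse f = g"
proof -
  have uniq: "h = g" if "f * h = 1" for h
  proof -
    have "h = (f * g) * h" by (simp only: assms mult_1_left)
    also have "\<dots> = g * (f * h)" by (simp only: mult_ac)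
    finally show ?thesis by (simp only: that mult_1_right)
  qed
  have "(THE g. f * g = 1) = g" by (rule the_equality) (fact assms, erule uniq)
  moreover have "\<exists>g. f * g = 1" using assms by (rule exI)
  ultimately show ?thesis by (simp only: inverse_mfps_def if_True)
qed

lift_definition mfps_var :: "'v \<Rightarrow> ('v, 'a::comm_ring_1) mfps"
  is "\<lambda>v m. if m = Poly_Mapping.single v 1 then 1 else 0" .


section \<open>The double Hilbert series\<close>

datatype hvar = T nat | Y nat

definition hvars :: "nat \<Rightarrow> nat \<Rightarrow> hvar set" where
  "hvars k l = T ` {..<k} \<union> Y ` {..<l}"

definition double_hilbert_series ::
  "('f::field \<Rightarrow> 'a::ring_1 \<Rightarrow> 'a) \<Rightarrow> nat \<Rightarrow> nat \<Rightarrow> (hvar, rat) mfps" where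
  "double_hilbert_series scl k l = Abs_mfps (\<lambda>m.
     if Poly_Mapping.keys m \<subseteq> hvars k l
     then of_nat (homogeneous_dim scl k l
            (\<lambda>i. Poly_Mapping.lookup m (T i)) (\<lambda>j. Poly_Mapping.lookup m (Y j)))
     else 0)"

end

theory Submission
  imports Defs
begin

text \<open>
  Write \<open>f\<^sub>I(\<sigma>)\<close> for the sign \<open>fsign n I \<sigma>\<close>. Substituting standard basis elements into a
  multilinear polynomial \<open>q = \<Sum>\<^sub>\<sigma> q(\<sigma>) \<sigma>\<close> gives the scalar \<open>\<Sum>\<^sub>\<sigma> q(\<sigma>) f\<^sub>I(\<sigma>)\<close> times a fixed
  product, where \<open>I\<close> collects the positions of the factors of odd length. By multilinearity
  \<open>Q\<^sub>n\<close> is therefore the common kernel of these linear forms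
  (\<open>multilinear_identities_grassmann\<close>).

  Fix a degree \<open>\<langle>a;b\<rangle>\<close>, a word \<open>w\<close> of that degree and the set \<open>J\<close> of positions of the \<open>z\<close>-letters
  in \<open>w\<close>. The space \<open>V\<langle>a;b\<rangle>\<close> is spanned by the rearrangements \<open>w\<sigma>\<close> of \<open>w\<close>, and the forms above
  turn into the functionals \<open>\<Phi>\<^sub>I(v) = \<Sum>\<^sub>\<sigma> v(w\<sigma>) f\<^sub>J(\<sigma>) f\<^sub>I(\<sigma>)\<close>, where \<open>v(u)\<close> is the coefficient of the
  word \<open>u\<close>. The subspace \<open>V\<langle>a;b\<rangle> * Q\<^sub>n\<close> is exactly their common kernel: the multiplicativity of
  the signs shows that it is contained in the kernel, and conversely \<open>v\<close> is, up to the order of the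
  stabilizer of \<open>w\<close>, equal to \<open>w * q\<close> with \<open>q(\<sigma>) = v(w\<sigma>) f\<^sub>J(\<sigma>)\<close>, and the forms take the values
  \<open>\<Phi>\<^sub>I(v)\<close> at this \<open>q\<close> (\<open>span_poly_act_identities\<close>).

  The dimension of the quotient is thus the number of independent functionals \<open>\<Phi>\<^sub>I\<close>.
  Sets \<open>I\<close> of odd size contribute nothing new, because \<open>f\<^sub>I\<close> is then an alternating sum of the
  \<open>f\<close> along \<open>I\<close> with one element removed (\<open>fsign_odd_expansion\<close>), whereas the functions \<open>f\<^sub>I\<close>
  for \<open>I\<close> of even size are linearly independent (\<open>even_fsigns_independent\<close>). Permutations that
  preserve the letters of \<open>w\<close> identify functionals up to sign. In terms of the symmetric
  difference \<open>D\<close> of \<open>I\<close> and \<open>J\<close> this means: \<open>\<Phi>\<^sub>I = 0\<close> if two positions in \<open>D\<close> carry the same letter,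
  and otherwise \<open>\<Phi>\<^sub>I\<close> is determined up to sign by the set \<open>S\<close> of letters at the positions in \<open>D\<close>.
  One functional for each \<open>S\<close> with \<open>|S| + |J|\<close> even remains, and these are independent since
  they involve disjoint families of even sets \<open>I\<close> and no cancellation occurs within a family.
  If \<open>s \<ge> 1\<close> letters occur in \<open>w\<close>, there are \<open>2\<^bsup>s-1\<^esup>\<close> such \<open>S\<close>, and there is one if \<open>w\<close> is empty.

  On the other side, \<open>(1 + t) / (1 - t) = 1 + 2t + 2t\<^sup>2 + \<dots>\<close>, so that the product of these series has
  the coefficient \<open>2\<^bsup>s\<^esup>\<close> at every monomial in which exactly \<open>s\<close> of the variables occur.
\<close>

section \<open>Signs of arrangements\<close>

text \<open>
  The sign of an arrangement is computed from its list of entries. Deleting or exchanging entries of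
  a list is easier to handle than the corresponding operations on permutations.
\<close>

fun inversion_sign :: "nat list \<Rightarrow> 'a::comm_ring_1" where
  "inversion_sign [] = 1"
| "inversion_sign (x # xs) = (- 1) ^ length (filter (\<lambda>y. y < x) xs) * inversion_sign xs"

lemma inversion_sign_cases:
  "inversion_sign xs = (1 :: 'a::comm_ring_1) \<or> inversion_sign xs = (- 1 :: 'a)"
  by (induction xs) (auto simp: minus_one_power_iff)

lemma inversion_sign_sorted: "sorted xs \<Longrightarrow> inversion_sign xs = 1"
proof (induction xs)
  case (Cons x xs)
  then have "filter (\<lambda>y. y < x) xs = []" by (auto simp: filter_empty_conv)
  with Cons show ?case by simp
qed simp

lemma inversion_sign_swap_adjacent:
  "x \<noteq> y \<Longrightarrow> inversion_sign (us @ x # y # vs) = - inversion_sign (us @ y # x # vs)"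
proof (induction us)
  case Nil
  then show ?case by (cases "x < y") auto
qed simp

lemma inversion_sign_move:
  "x \<notin> set us \<Longrightarrow>
    inversion_sign (ts @ us @ x # vs) =
      ((- 1) ^ length us * inversion_sign (ts @ x # us @ vs) :: 'a::comm_ring_1)"
proof (induction us arbitrary: ts)
  case (Cons y us)
  have "inversion_sign (ts @ (y # us) @ x # vs) = (inversion_sign ((ts @ [y]) @ us @ x # vs) :: 'a)"
    by simp
  also have "\<dots> = (- 1) ^ length us * inversion_sign (ts @ y # x # us @ vs)"
    using Cons.prems Cons.IH[of "ts @ [y]"] by simp
  finally show ?case
    using inversion_sign_swap_adjacent[of y x ts "us @ vs", where 'a = 'a] Cons.prems by simp
qed simp

lemma inversion_sign_swap:
  assumes "x \<noteq> y" "x \<notin> set vs" "y \<notin> set vs"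
  shows "inversion_sign (us @ x # vs @ y # ws) =
    (- inversion_sign (us @ y # vs @ x # ws) :: 'a::comm_ring_1)"
  using inversion_sign_move[of y "x # vs" us ws, where 'a = 'a]
    inversion_sign_move[of x vs "us @ [y]" ws, where 'a = 'a] assms
  by simp

lemma inversion_sign_remove:
  assumes "distinct (us @ x # vs)"
  shows "inversion_sign (us @ x # vs) =
    (- 1) ^ length us * (- 1) ^ card {y \<in> set (us @ x # vs). y < x} *
      (inversion_sign (us @ vs) :: 'a::comm_ring_1)"
proof -
  have "card {y \<in> set (us @ x # vs). y < x} = length (filter (\<lambda>y. y < x) (us @ vs))"
    using assms by (subst distinct_length_filter) (auto intro!: arg_cong[where f = card])
  then show ?thesis
    using inversion_sign_move[of x us "[]" vs, where 'a = 'a] assms by (simp add: mult.assoc)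
qed

lemma sum_alternating_odd: "odd m \<Longrightarrow> (\<Sum>p<m. (- 1) ^ p) = (1 :: 'a::comm_ring_1)"
proof -
  have "(\<Sum>p<m. (- 1) ^ p) = (if odd m then 1 else 0 :: 'a)" by (induction m) auto
  then show "odd m \<Longrightarrow> ?thesis" by simp
qed

text \<open>
  Moving the entry at position \<open>p\<close> to the front costs the sign \<open>(-1)\<^bsup>p\<^esup>\<close>, and deleting an entry \<open>x\<close>
  from the front costs a sign that depends on the set of entries only. Hence each summand on the
  right is \<open>(-1)\<^bsup>p\<^esup>\<close> times the left hand side, and an odd number of alternating signs adds up to \<open>1\<close>.
\<close>

lemma inversion_sign_odd_expansion:
  assumes "distinct v" "odd (length v)"
  shows "inversion_sign v =
    (\<Sum>x\<in>set v. (- 1) ^ card {y \<in> set v. y < x} * inversion_sign (filter (\<lambda>y. y \<noteq> x) v))"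
proof -
  have *: "(- 1) ^ card {y \<in> set v. y < v ! p} * inversion_sign (filter (\<lambda>y. y \<noteq> v ! p) v) =
      (- 1) ^ p * (inversion_sign v :: 'a)" if p: "p < length v" for p
  proof -
    let ?u = "take p v" and ?w = "drop (Suc p) v"
    have v: "v = ?u @ v ! p # ?w" using p by (rule id_take_nth_drop)
    have d: "distinct (?u @ v ! p # ?w)" using assms(1) v by simp
    have "filter (\<lambda>y. y \<noteq> v ! p) ?u = ?u" "filter (\<lambda>y. y \<noteq> v ! p) ?w = ?w"
      using d by (auto intro!: filter_True simp del: set_take_subset)
    then have "filter (\<lambda>y. y \<noteq> v ! p) (?u @ v ! p # ?w) = ?u @ ?w" by simp
    then have f: "filter (\<lambda>y. y \<noteq> v ! p) v = ?u @ ?w" using v by simp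
    have lu: "length ?u = p" using p by simp
    have "inversion_sign v = (- 1) ^ p * ((- 1) ^ card {y \<in> set v. y < v ! p} *
        (inversion_sign (filter (\<lambda>y. y \<noteq> v ! p) v) :: 'a))"
      using inversion_sign_remove[OF d] lu f v by (simp add: mult.assoc)
    moreover have "(- 1) ^ p * (- 1) ^ p = (1 :: 'a)" by (simp flip: power_add mult_2)
    ultimately show ?thesis by (simp add: mult.assoc[symmetric])
  qed
  have "(\<Sum>x\<in>set v. (- 1) ^ card {y \<in> set v. y < x} * inversion_sign (filter (\<lambda>y. y \<noteq> x) v)) =
      (\<Sum>p<length v. (- 1) ^ p * (inversion_sign v :: 'a))"
    by (rule sum.reindex_bij_betw[OF bij_betw_nth[OF assms(1) refl refl], symmetric,
          THEN trans]) (simp add: *)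
  also have "\<dots> = inversion_sign v"
    using assms(2) by (simp flip: sum_distrib_right add: sum_alternating_odd)
  finally show ?thesis by simp
qed

text \<open>
  Choose distinct \<open>a\<close> and \<open>b\<close> and subtract the relations for the arrangements \<open>a, b, v\<close> and
  \<open>b, a, v\<close>. Only the sets containing both \<open>a\<close> and \<open>b\<close> survive, and what remains is a relation of
  the same kind between the arrangements \<open>v\<close> of the other elements. By induction every coefficient at
  a set with at least two elements vanishes; among the sets of even size this leaves only the
  empty set, whose sign is constantly \<open>1\<close>.
\<close>

lemma even_inversion_signs_independent:
  fixes c :: "nat set \<Rightarrow> 'f::field_char_0"
  assumes "finite A"
    and "\<And>u. distinct u \<Longrightarrow> set u = A \<Longrightarrow>
      (\<Sum>I | I \<subseteq> A \<and> even (card I). c I * inversion_sign (filter (\<lambda>i. i \<in> I) u)) = 0"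
    and "I \<subseteq> A" "even (card I)"
  shows "c I = 0"
  using assms
proof (induction "card A" arbitrary: A c I rule: less_induct)
  case less
  note fin = less.prems(1)
  have two: "c I = 0" if I: "I \<subseteq> A" "even (card I)" and ab: "a \<in> I" "b \<in> I" "a \<noteq> b" for I a b
  proof -
    let ?A = "A - {a, b}"
    \<comment> \<open>the sign lost when \<open>a\<close> and \<open>b\<close> are deleted from the front of the arrangement\<close>
    define e :: "nat set \<Rightarrow> 'f" where
      "e I = (- 1) ^ (card {y \<in> I. y < a} + (if b < a then 1 else 0) + card {y \<in> I. y < b})" for I
    define d where "d I = 2 * e I * c (insert a (insert b I))" for I
    have abA: "a \<in> A" "b \<in> A" using I ab by auto
    have "d (I - {a, b}) = 0"
    proof (rule less.hyps)
      show "card ?A < card A" using abA fin by (intro psubset_card_mono) auto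
      show "finite ?A" using fin by simp
      show "I - {a, b} \<subseteq> ?A" using I by auto
      have "finite I" using I fin finite_subset by blast
      then show "even (card (I - {a, b}))" using I ab by (simp add: card_Diff_subset)
    next
      fix v :: "nat list" assume v: "distinct v" "set v = ?A"
      let ?s = "\<lambda>I u. inversion_sign (filter (\<lambda>i. i \<in> I) u) :: 'f"
      let ?E = "{I. I \<subseteq> A \<and> even (card I)}"
      have finE: "finite ?E" using fin by simp
      have set1: "distinct (a # b # v)" "set (a # b # v) = A"
        and set2: "distinct (b # a # v)" "set (b # a # v) = A" using v abA ab by auto
      have "0 = (\<Sum>I\<in>?E. c I * ?s I (a # b # v)) - (\<Sum>I\<in>?E. c I * ?s I (b # a # v))"
        using less.prems(2)[OF set1] less.prems(2)[OF set2] by simp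
      also have "\<dots> = (\<Sum>I\<in>?E. c I * (?s I (a # b # v) - ?s I (b # a # v)))"
        by (simp add: sum_subtractf algebra_simps)
      also have "\<dots> = (\<Sum>I\<in>?E. if a \<in> I \<and> b \<in> I then c I * (2 * ?s I (a # b # v)) else 0)"
      proof (rule sum.cong[OF refl])
        fix I
        show "c I * (?s I (a # b # v) - ?s I (b # a # v)) =
          (if a \<in> I \<and> b \<in> I then c I * (2 * ?s I (a # b # v)) else 0)"
          using inversion_sign_swap_adjacent[of a b "[]" "filter (\<lambda>i. i \<in> I) v", where 'a = 'f] ab
          by (auto simp del: inversion_sign.simps)
      qed
      also have "\<dots> = (\<Sum>I | I \<in> ?E \<and> a \<in> I \<and> b \<in> I. c I * (2 * ?s I (a # b # v)))"
        using finE by (simp add: sum.If_cases Int_def conj_ac)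
      also have "\<dots> = (\<Sum>I | I \<subseteq> ?A \<and> even (card I).
          c (insert a (insert b I)) * (2 * ?s (insert a (insert b I)) (a # b # v)))"
      proof (rule sum.reindex_bij_witness[where i = "\<lambda>I. insert a (insert b I)"
            and j = "\<lambda>I. I - {a, b}"])
        fix I assume I: "I \<in> {I. I \<in> ?E \<and> a \<in> I \<and> b \<in> I}"
        show eq: "insert a (insert b (I - {a, b})) = I" using I by auto
        have "finite I" using I fin finite_subset by blast
        then show "I - {a, b} \<in> {I. I \<subseteq> ?A \<and> even (card I)}"
          using I ab by (auto simp: card_Diff_subset)
        show "c (insert a (insert b (I - {a, b}))) *
            (2 * ?s (insert a (insert b (I - {a, b}))) (a # b # v)) = c I * (2 * ?s I (a # b # v))"
          by (simp only: eq)
      next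
        fix I assume I: "I \<in> {I. I \<subseteq> ?A \<and> even (card I)}"
        have "finite I" using I fin finite_subset[of I ?A] by auto
        then show "insert a (insert b I) \<in> {I. I \<in> ?E \<and> a \<in> I \<and> b \<in> I}"
          using I ab abA by (auto simp: card_insert_if)
        show "insert a (insert b I) - {a, b} = I" using I by auto
      qed
      also have "\<dots> = (\<Sum>I | I \<subseteq> ?A \<and> even (card I). d I * ?s I v)"
      proof (rule sum.cong[OF refl])
        fix I assume I: "I \<in> {I. I \<subseteq> ?A \<and> even (card I)}"
        have f: "filter (\<lambda>i. i \<in> insert a (insert b I)) v = filter (\<lambda>i. i \<in> I) v"
          using v by (intro filter_cong) auto
        have "length (filter (\<lambda>y. y < x) (filter (\<lambda>i. i \<in> I) v)) = card {y \<in> I. y < x}" for x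
          using v I by (subst distinct_length_filter) (auto intro!: arg_cong[where f = card])
        then show "c (insert a (insert b I)) *
            (2 * ?s (insert a (insert b I)) (a # b # v)) = d I * ?s I v"
          using f by (simp add: d_def e_def power_add mult_ac)
      qed
      finally show "(\<Sum>I | I \<subseteq> ?A \<and> even (card I). d I * ?s I v) = 0" by simp
    qed
    moreover have "insert a (insert b (I - {a, b})) = I" using ab by auto
    ultimately show ?thesis by (simp add: d_def e_def)
  qed
  show ?case
  proof (cases "I = {}")
    case False
    then obtain a where a: "a \<in> I" by auto
    have "I \<noteq> {a}" using less.prems(4) by auto
    then obtain b where "b \<in> I" "a \<noteq> b" using a by auto
    with two[OF less.prems(3,4) a] show ?thesis by blast
  next
    case True
    obtain u where u: "set u = A" "distinct u" using finite_distinct_list[OF fin] by blast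
    have "c I = 0" if I: "I \<subseteq> A" "even (card I)" "I \<noteq> {}" for I
    proof -
      obtain a where a: "a \<in> I" using I by auto
      have "I \<noteq> {a}" using I(2) by auto
      then obtain b where "b \<in> I" "a \<noteq> b" using a by auto
      with two[OF I(1,2) a] show ?thesis by blast
    qed
    then have "(\<Sum>I | I \<subseteq> A \<and> even (card I). c I * inversion_sign (filter (\<lambda>i. i \<in> I) u)) =
        (\<Sum>I\<in>{{}}. c I * inversion_sign (filter (\<lambda>i. i \<in> I) u))"
      using fin by (intro sum.mono_neutral_right) auto
    then show ?thesis using less.prems(2)[OF u(2,1)] True by simp
  qed
qed

section \<open>Products of basis elements of the Grassmann algebra\<close>

lemma gbasis_commute:
  fixes S T :: "nat set"
  assumes "finite S" "finite T"
  shows "gbasis S * gbasis T =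
    gscale ((- 1) ^ (card S * card T)) (gbasis T * gbasis S :: 'f::field grassmann)"
proof (cases "S \<inter> T = {}")
  case True
  let ?A = "{(s, t). s \<in> S \<and> t \<in> T \<and> t < s}" and ?B = "{(t, s). t \<in> T \<and> s \<in> S \<and> s < t}"
  have fin: "finite ?A" "finite ?B"
    using assms by (auto intro: finite_subset[of _ "S \<times> T"] finite_subset[of _ "T \<times> S"])
  have "S \<times> T = ?A \<union> prod.swap ` ?B"
    using True by (auto simp: image_iff not_less le_less)
  moreover have "?A \<inter> prod.swap ` ?B = {}" by auto
  ultimately have "card (S \<times> T) = card ?A + card ?B"
    using fin by (simp add: card_Un_disjoint card_image)
  then have "(- 1) ^ (card S * card T) = (gsign S T * gsign T S :: 'f)"
    by (simp add: gsign_def card_cartesian_product power_add)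
  moreover have "gsign T S * gsign T S = (1 :: 'f)"
    by (simp add: gsign_def flip: power_add mult_2)
  ultimately have "gsign S T = (- 1) ^ (card S * card T) * (gsign T S :: 'f)"
    by (simp add: mult.assoc)
  then show ?thesis
    using True assms by (simp add: gbasis_mult Int_commute Un_commute)
qed (use assms in \<open>simp add: gbasis_mult Int_commute\<close>)

text \<open>
  The new factor moves to its place by exchanging neighbours, and an exchange changes the sign
  exactly if both factors have odd length.
\<close>

lemma gbasis_mult_sorted_prod:
  fixes a :: "nat \<Rightarrow> nat set"
  assumes "sorted v" "\<forall>i\<in>set (x # v). finite (a i)"
  shows "gbasis (a x) * prod_list (map (\<lambda>i. gbasis (a i)) v) =
    gscale (if odd (card (a x)) then (- 1) ^ length (filter (\<lambda>y. y < x \<and> odd (card (a y))) v) else 1)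
      (prod_list (map (\<lambda>i. gbasis (a i)) (insort x v)) :: 'f::field grassmann)"
  using assms
proof (induction v)
  case (Cons y v)
  let ?P = "\<lambda>v. prod_list (map (\<lambda>i. gbasis (a i)) v) :: 'f grassmann"
  show ?case
  proof (cases "x \<le> y")
    case True
    then have "filter (\<lambda>y. y < x \<and> odd (card (a y))) (y # v) = []"
      using Cons.prems(1) by (auto simp: filter_empty_conv)
    then have "(- 1) ^ length (filter (\<lambda>y. y < x \<and> odd (card (a y))) (y # v)) = (1 :: 'f)"
      by (simp only: list.size power_0)
    then show ?thesis using True by (simp del: filter.simps)
  next
    case False
    have "gbasis (a x) * ?P (y # v) = (gbasis (a x) * gbasis (a y)) * ?P v"
      by (simp add: mult.assoc)
    also have "\<dots> = gscale ((- 1) ^ (card (a x) * card (a y))) (gbasis (a y) * (gbasis (a x) * ?P v))"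
      using Cons.prems(2) by (subst gbasis_commute) (auto simp: gscale_mult mult.assoc)
    finally show ?thesis
      using Cons False by (auto simp: gscale_mult minus_one_power_iff)
  qed
qed simp

text \<open>
  By insertion sort: inserting a factor of odd length costs one sign for each factor of odd length
  with smaller index to its right, that is, for each inversion counted by \<open>inversion_sign\<close>.
\<close>

lemma gbasis_prod_sort:
  fixes a :: "nat \<Rightarrow> nat set"
  assumes "\<forall>i\<in>set u. finite (a i)"
  shows "prod_list (map (\<lambda>i. gbasis (a i)) u) =
    gscale (inversion_sign (filter (\<lambda>i. odd (card (a i))) u))
      (prod_list (map (\<lambda>i. gbasis (a i)) (sort u)) :: 'f::field grassmann)"
  using assms
proof (induction u)
  case (Cons x u)
  have "mset (filter (\<lambda>y. y < x \<and> odd (card (a y))) (sort u)) =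
      mset (filter (\<lambda>y. y < x) (filter (\<lambda>i. odd (card (a i))) u))"
    by (simp add: filter_filter_mset conj_commute)
  then have "length (filter (\<lambda>y. y < x \<and> odd (card (a y))) (sort u)) =
      length (filter (\<lambda>y. y < x) (filter (\<lambda>i. odd (card (a i))) u))"
    by (rule mset_eq_length)
  then show ?case
    using Cons gbasis_mult_sorted_prod[of "sort u" x a, where 'f = 'f]
    by (simp add: gscale_mult mult.commute del: filter_filter)
qed simp

lemma gbasis_nonzero: "finite S \<Longrightarrow> gbasis S \<noteq> (0 :: 'f::field grassmann)"
  by transfer (auto simp: fun_eq_iff)

lemma gbasis_prod_disjoint:
  assumes "distinct u" "\<forall>i\<in>set u. finite (a i)" "disjoint_family_on a (set u)"
  shows "\<exists>s. s \<noteq> 0 \<and> prod_list (map (\<lambda>i. gbasis (a i)) u) =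
    (gscale s (gbasis (\<Union> (a ` set u))) :: 'f::field grassmann)"
  using assms
proof (induction u)
  case Nil
  have "gbasis {} = (1 :: 'f grassmann)" by transfer auto
  then show ?case by (intro exI[of _ 1]) simp
next
  case (Cons x u)
  then obtain s where s: "s \<noteq> 0" "prod_list (map (\<lambda>i. gbasis (a i)) u) =
    (gscale s (gbasis (\<Union> (a ` set u))) :: 'f grassmann)"
    by (auto simp: disjoint_family_on_def)
  have d: "a x \<inter> \<Union> (a ` set u) = {}"
    using Cons.prems by (fastforce simp: disjoint_family_on_def)
  show ?case
    by (intro exI[of _ "s * gsign (a x) (\<Union> (a ` set u))"])
      (use Cons.prems s d in \<open>auto simp: gscale_mult gbasis_mult gsign_def\<close>)
qed

section \<open>The signs of permutations\<close>

abbreviation arrangement :: "nat \<Rightarrow> (nat \<Rightarrow> nat) \<Rightarrow> nat list" where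
  "arrangement n \<sigma> \<equiv> map \<sigma> [0..<n]"

lemma arrangement_permutes:
  assumes "\<sigma> permutes {..<n}"
  shows "distinct (arrangement n \<sigma>)" "set (arrangement n \<sigma>) = {..<n}"
    "sort (arrangement n \<sigma>) = [0..<n]"
proof -
  show d: "distinct (arrangement n \<sigma>)"
    using permutes_inj_on[OF assms, of "{0..<n}"] by (simp add: distinct_map)
  show s: "set (arrangement n \<sigma>) = {..<n}"
    using permutes_image[OF assms] by (simp add: atLeast0LessThan)
  have "set (sort (arrangement n \<sigma>)) = set [0..<n]"
    using s by (simp add: atLeast0LessThan)
  then show "sort (arrangement n \<sigma>) = [0..<n]"
    using d by (intro sorted_distinct_set_unique) auto
qed

lemma arrangement_surj:
  assumes "distinct u" "set u = {..<n}"
  obtains \<sigma> where "\<sigma> permutes {..<n}" "arrangement n \<sigma> = u"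
proof -
  define \<sigma> where "\<sigma> i = (if i < n then u ! i else i)" for i
  have len: "length u = n" using assms distinct_card by fastforce
  have "bij_betw \<sigma> {..<n} {..<n} = bij_betw ((!) u) {..<n} {..<n}"
    by (rule bij_betw_cong) (simp add: \<sigma>_def)
  then have "bij_betw \<sigma> {..<n} {..<n}"
    using bij_betw_nth[OF assms(1)] assms(2) len by simp
  then have "\<sigma> permutes {..<n}" by (rule bij_imp_permutes) (simp add: \<sigma>_def)
  moreover have "arrangement n \<sigma> = u"
    by (rule nth_equalityI) (simp_all add: len \<sigma>_def)
  ultimately show thesis by (rule that)
qed

lemma arrangement_inject:
  assumes "\<sigma> permutes {..<n}" "\<tau> permutes {..<n}" "arrangement n \<sigma> = arrangement n \<tau>"
  shows "\<sigma> = \<tau>"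
proof
  fix i show "\<sigma> i = \<tau> i"
    using assms permutes_not_in[OF assms(1), of i] permutes_not_in[OF assms(2), of i]
    by (cases "i < n") auto
qed

lemma gadmissible_exists:
  assumes "I \<subseteq> {..<n}"
  shows "\<exists>a. gadmissible TYPE('f::field) n I a"
proof -
  let ?a = "\<lambda>i. if i \<in> I then {i} else {}"
  have "\<exists>s. s \<noteq> 0 \<and> prod_list (map (\<lambda>i. gbasis (?a i)) [0..<n]) =
      (gscale s (gbasis (\<Union> (?a ` set [0..<n]))) :: 'f grassmann)"
    by (rule gbasis_prod_disjoint) (auto simp: disjoint_family_on_def)
  then obtain s where "s \<noteq> 0" "prod_list (map (\<lambda>i. gbasis (?a i)) [0..<n]) =
      (gscale s (gbasis (\<Union> (?a ` set [0..<n]))) :: 'f grassmann)"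
    by blast
  then have "gadmissible TYPE('f) n I ?a"
    using assms by (auto simp: gadmissible_def gbasis_nonzero split: if_splits)
  then show ?thesis by blast
qed

lemma gbasis_prod_permute:
  assumes a: "\<forall>i<n. finite (a i)" and \<sigma>: "\<sigma> permutes {..<n}"
  shows "prod_list (map (\<lambda>i. gbasis (a (\<sigma> i))) [0..<n]) =
    gscale (inversion_sign (filter (\<lambda>i. i \<in> {i. i < n \<and> odd (card (a i))}) (arrangement n \<sigma>)))
      (prod_list (map (\<lambda>i. gbasis (a i)) [0..<n]) :: 'f::field grassmann)"
proof -
  have "filter (\<lambda>i. odd (card (a i))) (arrangement n \<sigma>) =
      filter (\<lambda>i. i \<in> {i. i < n \<and> odd (card (a i))}) (arrangement n \<sigma>)"
    using arrangement_permutes(2)[OF \<sigma>] by (intro filter_cong) auto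
  moreover have "\<forall>i\<in>set (arrangement n \<sigma>). finite (a i)"
    unfolding arrangement_permutes(2)[OF \<sigma>] using a by simp
  ultimately show ?thesis
    using gbasis_prod_sort[of "arrangement n \<sigma>" a, where 'f = 'f] arrangement_permutes(3)[OF \<sigma>]
    by (simp add: comp_def)
qed

text \<open>
  The definition of the sign refers to all admissible factors at once. Sorting the factors gives a
  value that serves all of them, and it is the only one because an admissible product is nonzero.
\<close>

lemma fsign_eq:
  assumes \<sigma>: "\<sigma> permutes {..<n}" and I: "I \<subseteq> {..<n}"
  shows "fsign n I \<sigma> = (inversion_sign (filter (\<lambda>i. i \<in> I) (arrangement n \<sigma>)) :: 'f::field)"
  unfolding fsign_def
proof (rule the_equality)
  let ?s = "inversion_sign (filter (\<lambda>i. i \<in> I) (arrangement n \<sigma>)) :: 'f"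
  let ?Q = "\<lambda>s::'f. \<forall>a. gadmissible TYPE('f) n I a \<longrightarrow>
        prod_list (map (\<lambda>i. gbasis (a (\<sigma> i))) [0..<n]) =
        gscale s (prod_list (map (\<lambda>i. gbasis (a i)) [0..<n]))"
  have Q: "?Q ?s" unfolding gadmissible_def using gbasis_prod_permute[OF _ \<sigma>] by blast
  then show "(?s = 1 \<or> ?s = - 1) \<and> ?Q ?s" using inversion_sign_cases by blast
  fix s assume s: "(s = 1 \<or> s = - 1) \<and> ?Q s"
  obtain a where a: "gadmissible TYPE('f) n I a" using gadmissible_exists[OF I] by blast
  let ?p = "prod_list (map (\<lambda>i. gbasis (a i)) [0..<n]) :: 'f grassmann"
  have "gscale s ?p = gscale ?s ?p" using s Q a by metis
  moreover have "?p \<noteq> 0" using a by (simp add: gadmissible_def)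
  ultimately show "s = ?s" by simp
qed

lemma fsign_square:
  assumes "\<sigma> permutes {..<n}" "I \<subseteq> {..<n}"
  shows "fsign n I \<sigma> * fsign n I \<sigma> = (1 :: 'f::field)"
  using inversion_sign_cases[of "filter (\<lambda>i. i \<in> I) (arrangement n \<sigma>)", where 'a = 'f]
  by (auto simp: fsign_eq[OF assms])

abbreviation pull :: "nat \<Rightarrow> (nat \<Rightarrow> nat) \<Rightarrow> nat set \<Rightarrow> nat set" where
  "pull n \<sigma> I \<equiv> {i. i < n \<and> \<sigma> i \<in> I}"

text \<open>
  Permuting the factors first by \<open>\<rho>\<close> moves the odd ones to the preimage of \<open>I\<close>; comparing the two
  ways of computing the product of the twice permuted factors gives the cocycle rule.
\<close>

lemma fsign_compose:
  assumes \<rho>: "\<rho> permutes {..<n}" and \<tau>: "\<tau> permutes {..<n}" and I: "I \<subseteq> {..<n}"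
  shows "fsign n I (\<rho> \<circ> \<tau>) = (fsign n I \<rho> * fsign n (pull n \<rho> I) \<tau> :: 'f::field)"
proof -
  obtain a where a: "gadmissible TYPE('f) n I a" using gadmissible_exists[OF I] by blast
  let ?P = "\<lambda>a. prod_list (map (\<lambda>i. gbasis (a i)) [0..<n]) :: 'f grassmann"
  have fin: "\<forall>i<n. finite (a i)" and nz: "?P a \<noteq> 0" and Ia: "{i. i < n \<and> odd (card (a i))} = I"
    using a by (auto simp: gadmissible_def)
  have eq: "?P (b \<circ> \<sigma>) = gscale (fsign n {i. i < n \<and> odd (card (b i))} \<sigma>) (?P b)"
    if "\<sigma> permutes {..<n}" "\<forall>i<n. finite (b i)" for \<sigma> b
    using gbasis_prod_permute[OF that(2,1), where 'f = 'f] that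
    by (subst fsign_eq[OF that(1)]) (auto simp: comp_def)
  have fin': "\<forall>i<n. finite ((a \<circ> \<rho>) i)" using fin permutes_in_image[OF \<rho>] by auto
  have pI: "{i. i < n \<and> odd (card ((a \<circ> \<rho>) i))} = pull n \<rho> I"
    using Ia permutes_in_image[OF \<rho>] by auto
  have "gscale (fsign n I (\<rho> \<circ> \<tau>)) (?P a) = ?P (a \<circ> \<rho> \<circ> \<tau>)"
    using eq[OF permutes_compose[OF \<tau> \<rho>] fin] Ia by (simp add: comp_assoc)
  also have "\<dots> = gscale (fsign n (pull n \<rho> I) \<tau>) (?P (a \<circ> \<rho>))"
    using eq[OF \<tau> fin'] pI by simp
  also have "?P (a \<circ> \<rho>) = gscale (fsign n I \<rho>) (?P a)" using eq[OF \<rho> fin] Ia by simp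
  finally show ?thesis using nz by (simp add: mult.commute comp_def)
qed

lemma fsign_transpose:
  assumes "p \<in> I" "q \<in> I" "p \<noteq> q" and I: "I \<subseteq> {..<n}"
  shows "fsign n I (transpose p q) = (- 1 :: 'f::field)"
proof -
  have main: "fsign n I (transpose p q) = (- 1 :: 'f)" if "p \<in> I" "q \<in> I" "p < q" for p q
  proof -
    have pq: "p < n" "q < n" using that I by auto
    have perm: "transpose p q permutes {..<n}" using pq by (simp add: permutes_swap_id)
    have u: "[0..<n] = [0..<p] @ p # [Suc p..<q] @ q # [Suc q..<n]"
    proof -
      have "[0..<n] = [0..<p] @ [p..<q] @ [q..<n]"
        using that pq upt_add_eq_append[of 0 p "n - p"] upt_add_eq_append[of p q "n - q"] by simp
      then show ?thesis using that pq by (simp add: upt_conv_Cons)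
    qed
    have "map (transpose p q) us = us" if "p \<notin> set us" "q \<notin> set us" for us
      using that by (intro map_idI) (auto simp: transpose_def)
    then have "arrangement n (transpose p q) =
        [0..<p] @ q # [Suc p..<q] @ p # [Suc q..<n]"
      unfolding u using that by simp
    then have "fsign n I (transpose p q) = (inversion_sign (filter (\<lambda>i. i \<in> I) [0..<p] @ q #
        filter (\<lambda>i. i \<in> I) [Suc p..<q] @ p # filter (\<lambda>i. i \<in> I) [Suc q..<n]) :: 'f)"
      using that by (simp add: fsign_eq[OF perm I])
    also have "\<dots> = - inversion_sign (filter (\<lambda>i. i \<in> I) ([0..<p] @ p # [Suc p..<q] @ q # [Suc q..<n]))"
      using that by (subst inversion_sign_swap) auto
    also have "\<dots> = - inversion_sign (filter (\<lambda>i. i \<in> I) [0..<n])" by (simp only: u)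
    also have "\<dots> = - 1"
      by (subst inversion_sign_sorted) (auto intro: sorted_filter[where f = id, simplified])
    finally show ?thesis .
  qed
  show ?thesis
  proof (cases "p < q")
    case False
    then show ?thesis using main[of q p] assms by (simp add: transpose_commute)
  qed (use main assms in blast)
qed

text \<open>
  If \<open>\<gamma>\<close> maps \<open>I\<close> to itself, the entries of the arrangement that lie in \<open>I\<close> are determined by the
  restriction of \<open>\<gamma>\<close> to \<open>I\<close>. On the permutations of \<open>I\<close> the cocycle rule becomes multiplicativity,
  so the value \<open>-1\<close> at transpositions forces the usual sign. Two sets that differ only in fixed
  points of \<open>\<gamma>\<close> thus give the same sign.
\<close>

lemma fsign_eq_sign:
  assumes \<gamma>: "\<gamma> permutes {..<n}" and I: "I \<subseteq> {..<n}" and stab: "pull n \<gamma> I = I"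
  shows "fsign n I \<gamma> = (of_int (sign (\<lambda>i. if i \<in> I then \<gamma> i else i)) :: 'f::field)"
proof -
  let ?g = "\<lambda>i. if i \<in> I then \<gamma> i else i"
  have finI: "finite I" using I finite_subset by blast
  have permI: "fsign n I \<pi> = (of_int (sign \<pi>) :: 'f)" if "\<pi> permutes I" for \<pi>
    using that finI
  proof (induction rule: permutes_induct)
    case id
    have "fsign n I id = (inversion_sign (filter (\<lambda>i. i \<in> I) [0..<n]) :: 'f)"
      using fsign_eq[OF permutes_id I, where 'f = 'f] by simp
    then show ?case
      by (subst (asm) inversion_sign_sorted)
        (auto intro: sorted_filter[where f = id, simplified] simp: id_def)
  next
    case (swap a b p)
    have t: "transpose a b permutes {..<n}" using swap.hyps(1,2) I by (intro permutes_swap_id) auto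
    have p: "p permutes {..<n}" using swap.hyps(4) I by (rule permutes_subset)
    have "pull n (transpose a b) I = I"
      using swap(1,2) I by (auto simp: transpose_def split: if_splits)
    then have "fsign n I (transpose a b \<circ> p) = - (fsign n I p :: 'f)"
      using fsign_compose[OF t p I, where 'f = 'f] fsign_transpose[OF swap.hyps(1-3) I, where 'f = 'f]
      by simp
    moreover have "permutation p" using swap.hyps(4) finI permutation_permutes by blast
    ultimately have "fsign n I (transpose a b \<circ> p) = (of_int (sign (transpose a b \<circ> p)) :: 'f)"
      using swap by (subst sign_compose) (simp_all add: permutation_swap_id sign_swap_id)
    then show ?case by (simp add: comp_def)
  qed
  have im: "\<gamma> i \<in> I \<longleftrightarrow> i \<in> I" for i
  proof (cases "i < n")
    case True then show ?thesis using stab by auto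
  next
    case False then show ?thesis using permutes_not_in[OF \<gamma>, of i] by simp
  qed
  have "inj_on ?g I" using permutes_inj_on[OF \<gamma>] by (simp add: inj_on_def)
  moreover have "?g ` I \<subseteq> I" using im by auto
  ultimately have "bij_betw ?g I I"
    using finI endo_inj_surj[of I ?g] by (auto simp: bij_betw_def)
  then have g: "?g permutes I" by (rule bij_imp_permutes) simp
  have gn: "?g permutes {..<n}" using g I by (rule permutes_subset)
  have "filter (\<lambda>i. i \<in> I) (arrangement n \<gamma>) = filter (\<lambda>i. i \<in> I) (arrangement n ?g)"
  proof -
    have "filter (\<lambda>i. i \<in> I) (arrangement n \<gamma>) = map \<gamma> (filter (\<lambda>i. i \<in> I) [0..<n])"
      by (simp add: filter_map comp_def im)
    also have "\<dots> = map ?g (filter (\<lambda>i. i \<in> I) [0..<n])" by simp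
    also have "\<dots> = filter (\<lambda>i. i \<in> I) (arrangement n ?g)"
      unfolding filter_map by (intro arg_cong[where f = "map ?g"] filter_cong) (auto simp: im)
    finally show ?thesis .
  qed
  then have "fsign n I \<gamma> = (fsign n I ?g :: 'f)"
    using fsign_eq[OF \<gamma> I, where 'f = 'f] fsign_eq[OF gn I, where 'f = 'f] by simp
  then show ?thesis using permI[OF g] by simp
qed

text \<open>
  The essential point is that the coefficients do not depend on \<open>\<sigma>\<close>: the signs along sets of odd
  size lie in the span of the signs along sets of even size.
\<close>

lemma fsign_odd_expansion:
  assumes \<sigma>: "\<sigma> permutes {..<n}" and I: "I \<subseteq> {..<n}" "odd (card I)"
  shows "fsign n I \<sigma> = (\<Sum>x\<in>I. (- 1) ^ card {y \<in> I. y < x} * (fsign n (I - {x}) \<sigma> :: 'f::field))"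
proof -
  let ?v = "filter (\<lambda>i. i \<in> I) (arrangement n \<sigma>)"
  note arr = arrangement_permutes[OF \<sigma>]
  have v: "set ?v = I" "distinct ?v"
    using arr(1,2) I by (auto simp del: set_map)
  then have "length ?v = card I" using distinct_card by metis
  then have "fsign n I \<sigma> = (\<Sum>x\<in>I. (- 1) ^ card {y \<in> I. y < x} *
      (inversion_sign (filter (\<lambda>y. y \<noteq> x) ?v) :: 'f))"
    using inversion_sign_odd_expansion[OF v(2), where 'a = 'f] I fsign_eq[OF \<sigma> I(1), where 'f = 'f]
    by (simp only: v(1)) simp
  also have "\<dots> = (\<Sum>x\<in>I. (- 1) ^ card {y \<in> I. y < x} * fsign n (I - {x}) \<sigma>)"
  proof (rule sum.cong[OF refl])
    fix x
    have "I - {x} \<subseteq> {..<n}" using I by auto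
    moreover have "filter (\<lambda>y. y \<noteq> x) ?v = filter (\<lambda>i. i \<in> I - {x}) (arrangement n \<sigma>)"
      by (simp add: conj_commute)
    ultimately show "(- 1) ^ card {y \<in> I. y < x} * inversion_sign (filter (\<lambda>y. y \<noteq> x) ?v) =
        (- 1) ^ card {y \<in> I. y < x} * (fsign n (I - {x}) \<sigma> :: 'f)"
      using fsign_eq[OF \<sigma>, of "I - {x}", where 'f = 'f] by simp
  qed
  finally show ?thesis .
qed

lemma even_fsigns_independent:
  fixes c :: "nat set \<Rightarrow> 'f::field_char_0"
  assumes "\<And>\<sigma>. \<sigma> permutes {..<n} \<Longrightarrow>
      (\<Sum>I | I \<subseteq> {..<n} \<and> even (card I). c I * fsign n I \<sigma>) = 0"
    and "I \<subseteq> {..<n}" "even (card I)"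
  shows "c I = 0"
proof (rule even_inversion_signs_independent[where A = "{..<n}", OF _ _ assms(2,3)])
  fix u :: "nat list" assume "distinct u" "set u = {..<n}"
  then obtain \<sigma> where \<sigma>: "\<sigma> permutes {..<n}" "arrangement n \<sigma> = u" by (rule arrangement_surj)
  have "(\<Sum>I | I \<subseteq> {..<n} \<and> even (card I). c I * inversion_sign (filter (\<lambda>i. i \<in> I) u)) =
      (\<Sum>I | I \<subseteq> {..<n} \<and> even (card I). c I * fsign n I \<sigma>)"
    by (rule sum.cong) (use \<sigma> in \<open>auto simp: fsign_eq\<close>)
  then show "(\<Sum>I | I \<subseteq> {..<n} \<and> even (card I).
      c I * inversion_sign (filter (\<lambda>i. i \<in> I) u)) = 0"
    using assms(1)[OF \<sigma>(1)] by simp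
qed simp

section \<open>The multilinear identities of the Grassmann algebra\<close>

lemma gcoeff_sum: "gcoeff (sum f A) S = (\<Sum>x\<in>A. gcoeff (f x) S)"
  by (induction A rule: infinite_finite_induct) (simp_all add: zero_grassmann.rep_eq plus_grassmann.rep_eq)

lemma grassmann_span_gbasis:
  "grassmann.span {gbasis S | S. finite S} = (UNIV :: 'f::field grassmann set)"
proof -
  have "x \<in> grassmann.span {gbasis S | S. finite S}" for x :: "'f grassmann"
  proof -
    let ?A = "{S. gcoeff x S \<noteq> 0}"
    have A: "finite ?A" "\<And>S. S \<in> ?A \<Longrightarrow> finite S" using gcoeff[of x] by auto
    have "gcoeff (\<Sum>S\<in>?A. gscale (gcoeff x S) (gbasis S)) T = gcoeff x T" for T
    proof -
      have "gcoeff (\<Sum>S\<in>?A. gscale (gcoeff x S) (gbasis S)) T =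
          (\<Sum>S\<in>?A. if T = S then gcoeff x T else 0)"
        unfolding gcoeff_sum using A(2)
        by (intro sum.cong) (auto simp: gscale.rep_eq gbasis.rep_eq)
      also have "\<dots> = gcoeff x T" using A(1) by simp
      finally show ?thesis .
    qed
    then have "(\<Sum>S\<in>?A. gscale (gcoeff x S) (gbasis S)) = x"
      by (simp add: gcoeff_inject[symmetric] fun_eq_iff)
    moreover have "(\<Sum>S\<in>?A. gscale (gcoeff x S) (gbasis S)) \<in>
        grassmann.span {gbasis S | S. finite S}"
      using A(2) by (intro grassmann.span_sum grassmann.span_scale grassmann.span_base) auto
    ultimately show ?thesis by simp
  qed
  then show ?thesis by auto
qed

lemma eval_multilinear:
  assumes "q \<in> multilinear_polys n"
  shows "eval_poly gscale a q = (\<Sum>\<sigma> | \<sigma> permutes {..<n}.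
    gscale (Poly_Mapping.lookup q (arrangement n \<sigma>)) (prod_list (map a (arrangement n \<sigma>)))
      :: 'f::field grassmann)"
proof -
  let ?P = "{\<sigma>. \<sigma> permutes {..<n}}"
  let ?t = "\<lambda>w. gscale (Poly_Mapping.lookup q w) (prod_list (map a w))"
  have "eval_poly gscale a q = sum ?t (arrangement n ` ?P)"
    unfolding eval_poly_def
  proof (rule sum.mono_neutral_left)
    show "Poly_Mapping.keys q \<subseteq> arrangement n ` ?P"
      using assms by (auto simp: multilinear_polys_def)
  qed (auto simp: in_keys_iff finite_permutations)
  also have "\<dots> = (\<Sum>\<sigma>\<in>?P. ?t (arrangement n \<sigma>))"
    by (rule sum.reindex_cong[OF _ refl refl]) (auto intro!: inj_onI arrangement_inject)
  finally show ?thesis .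
qed

lemma prod_list_update_linear:
  fixes a :: "nat \<Rightarrow> 'a::ring_1"
  assumes "distinct u" "m \<in> set u"
  shows "\<exists>b c. \<forall>x. prod_list (map (a(m := x)) u) = b * x * c"
proof -
  obtain us vs where u: "u = us @ m # vs" using assms(2) by (auto simp: in_set_conv_decomp)
  have "prod_list (map (a(m := x)) u) = prod_list (map a us) * x * prod_list (map a vs)" for x
  proof -
    have "map (a(m := x)) us = map a us" "map (a(m := x)) vs = map a vs"
      using assms(1) u by auto
    then show ?thesis
      by (simp only: u map_append list.map prod_list.append prod_list.Cons fun_upd_same mult.assoc)
  qed
  then show ?thesis by blast
qed

text \<open>
  The basis elements are replaced by arbitrary ones one argument at a time: as a function of a single
  argument the value is linear, so it vanishes everywhere if it vanishes on a spanning set.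
\<close>

lemma multilinear_vanishes:
  fixes q :: "nat list \<Rightarrow>\<^sub>0 'f::field"
  assumes q: "q \<in> multilinear_polys n"
    and basis: "\<And>A. \<forall>i. finite (A i) \<Longrightarrow> eval_poly gscale (\<lambda>i. gbasis (A i)) q = 0"
  shows "eval_poly gscale a q = 0"
proof -
  let ?B = "{gbasis S | S. finite S} :: 'f grassmann set"
  let ?E = "\<lambda>a. eval_poly gscale a q"
  have cong: "?E a = ?E b" if "\<forall>i<n. a i = b i" for a b :: "nat \<Rightarrow> 'f grassmann"
    unfolding eval_multilinear[OF q]
  proof (intro sum.cong refl arg_cong2[where f = gscale] arg_cong[where f = prod_list] map_cong)
    fix \<sigma> i assume "\<sigma> \<in> {\<sigma>. \<sigma> permutes {..<n}}" "i \<in> set (arrangement n \<sigma>)"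
    then show "a i = b i" using arrangement_permutes(2)[of \<sigma> n] that by auto
  qed
  have "?E a = 0" if "\<forall>i. m \<le> i \<and> i < n \<longrightarrow> a i \<in> ?B" for m a
    using that
  proof (induction m arbitrary: a)
    case 0
    then have "\<forall>i. \<exists>S. finite S \<and> (i < n \<longrightarrow> a i = gbasis S)" by blast
    then obtain A where "\<forall>i. finite (A i) \<and> (i < n \<longrightarrow> a i = gbasis (A i))" by metis
    then show ?case using basis[of A] cong[of a "\<lambda>i. gbasis (A i)"] by simp
  next
    case (Suc m)
    show ?case
    proof (cases "m < n")
      case False
      then show ?thesis by (intro Suc.IH) auto
    next
      case True
      define L where "L x = ?E (a(m := x))" for x
      have lin: "\<exists>b c. \<forall>x. prod_list (map (a(m := x)) (arrangement n \<sigma>)) = b * x * c"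
        if "\<sigma> permutes {..<n}" for \<sigma>
        using arrangement_permutes[OF that] True by (intro prod_list_update_linear) auto
      have add: "L (x + y) = L x + L y" for x y
        unfolding L_def eval_multilinear[OF q] sum.distrib[symmetric]
      proof (rule sum.cong[OF refl])
        fix \<sigma> assume "\<sigma> \<in> {\<sigma>. \<sigma> permutes {..<n}}"
        then obtain b c where "\<forall>x. prod_list (map (a(m := x)) (arrangement n \<sigma>)) = b * x * c"
          using lin by blast
        then show "gscale (Poly_Mapping.lookup q (arrangement n \<sigma>))
              (prod_list (map (a(m := x + y)) (arrangement n \<sigma>))) =
            gscale (Poly_Mapping.lookup q (arrangement n \<sigma>))
              (prod_list (map (a(m := x)) (arrangement n \<sigma>))) +
            gscale (Poly_Mapping.lookup q (arrangement n \<sigma>))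
              (prod_list (map (a(m := y)) (arrangement n \<sigma>)))"
          by (simp add: algebra_simps grassmann.scale_right_distrib del: map_map)
      qed
      have scale: "L (gscale r x) = gscale r (L x)" for r x
        unfolding L_def eval_multilinear[OF q] grassmann.scale_sum_right
      proof (rule sum.cong[OF refl])
        fix \<sigma> assume "\<sigma> \<in> {\<sigma>. \<sigma> permutes {..<n}}"
        then obtain b c where "\<forall>x. prod_list (map (a(m := x)) (arrangement n \<sigma>)) = b * x * c"
          using lin by blast
        then show "gscale (Poly_Mapping.lookup q (arrangement n \<sigma>))
              (prod_list (map (a(m := gscale r x)) (arrangement n \<sigma>))) =
            gscale r (gscale (Poly_Mapping.lookup q (arrangement n \<sigma>))
              (prod_list (map (a(m := x)) (arrangement n \<sigma>))))"
          by (simp add: gscale_mult mult.commute del: map_map)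
      qed
      have "grassmann.span ?B \<subseteq> {x. L x = 0}"
      proof (rule grassmann.span_minimal)
        show "?B \<subseteq> {x. L x = 0}"
          unfolding L_def using Suc by (auto intro!: Suc.IH)
        have "L 0 = 0" using scale[of 0 0] by simp
        then show "grassmann.subspace {x. L x = 0}"
          by (intro grassmann.subspaceI) (simp_all add: add scale)
      qed
      then have "L (a m) = 0" unfolding grassmann_span_gbasis by blast
      then show ?thesis by (simp add: L_def)
    qed
  qed
  moreover have "\<forall>i. n \<le> i \<and> i < n \<longrightarrow> a i \<in> ?B" by auto
  ultimately show ?thesis by blast
qed

text \<open>
  If the product of the substituted basis elements vanishes, then it vanishes in every order.
  Otherwise reordering costs the sign along the set of odd factors, and every set \<open>I\<close>
  arises in this way.
\<close>

lemma multilinear_identities_grassmann: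
  fixes q :: "nat list \<Rightarrow>\<^sub>0 'f::field"
  shows "q \<in> multilinear_identities gscale n \<longleftrightarrow> q \<in> multilinear_polys n \<and>
    (\<forall>I\<subseteq>{..<n}. (\<Sum>\<sigma> | \<sigma> permutes {..<n}. Poly_Mapping.lookup q (arrangement n \<sigma>) * fsign n I \<sigma>) = 0)"
proof -
  let ?c = "\<lambda>I. \<Sum>\<sigma> | \<sigma> permutes {..<n}. Poly_Mapping.lookup q (arrangement n \<sigma>) * fsign n I \<sigma>"
  have eval: "eval_poly gscale (\<lambda>i. gbasis (A i)) q =
      gscale (?c {i. i < n \<and> odd (card (A i))}) (prod_list (map (\<lambda>i. gbasis (A i)) [0..<n]))"
    if "q \<in> multilinear_polys n" "\<forall>i<n. finite (A i)" for A
  proof -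
    have sub: "{i. i < n \<and> odd (card (A i))} \<subseteq> {..<n}" by auto
    show ?thesis
      unfolding eval_multilinear[OF that(1)] grassmann.scale_sum_left
    proof (rule sum.cong[OF refl])
      fix \<sigma> assume "\<sigma> \<in> {\<sigma>. \<sigma> permutes {..<n}}"
      then have \<sigma>: "\<sigma> permutes {..<n}" by simp
      show "gscale (Poly_Mapping.lookup q (arrangement n \<sigma>))
          (prod_list (map (\<lambda>i. gbasis (A i)) (arrangement n \<sigma>))) =
        gscale (Poly_Mapping.lookup q (arrangement n \<sigma>) * fsign n {i. i < n \<and> odd (card (A i))} \<sigma>)
          (prod_list (map (\<lambda>i. gbasis (A i)) [0..<n]))"
        unfolding fsign_eq[OF \<sigma> sub]
        using gbasis_prod_permute[OF that(2) \<sigma>, where 'f = 'f] by (simp add: comp_def)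
    qed
  qed
  show ?thesis
  proof (intro iffI conjI allI impI)
    assume "q \<in> multilinear_identities gscale n"
    then have q: "q \<in> multilinear_polys n" and id: "\<And>a. eval_poly gscale a q = 0"
      by (auto simp: multilinear_identities_def identities_def)
    show "q \<in> multilinear_polys n" by fact
    fix I :: "nat set" assume "I \<subseteq> {..<n}"
    then obtain A where "gadmissible TYPE('f) n I A" using gadmissible_exists by blast
    then show "?c I = 0" using eval[OF q, of A] id by (auto simp: gadmissible_def)
  next
    assume asm: "q \<in> multilinear_polys n \<and> (\<forall>I\<subseteq>{..<n}. ?c I = 0)"
    then have "eval_poly gscale (\<lambda>i. gbasis (A i)) q = 0" if "\<forall>i. finite (A i)" for A
      using eval[of A] that by (auto simp: subset_iff)
    then show "q \<in> multilinear_identities gscale n"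
      using multilinear_vanishes asm by (auto simp: multilinear_identities_def identities_def)
  qed
qed

section \<open>The subspace generated by the identities\<close>

text \<open>
  The homogeneous part is described by a single word of the required degree, since it is spanned
  by the rearrangements of that word.
\<close>

definition content_space :: "gen list \<Rightarrow> (gen list \<Rightarrow>\<^sub>0 'f::field) set" where
  "content_space w = {p. \<forall>u\<in>Poly_Mapping.keys p. mset u = mset w}"

definition odd_positions :: "gen list \<Rightarrow> nat set" where
  "odd_positions w = {i. i < length w \<and> w ! i \<in> range Z}"

text \<open>
  This is \<open>\<Phi>\<^sub>I\<close>. The factor \<open>f\<^sub>J\<close> compensates the sign in the action on \<open>w\<close>, so that the value at
  \<open>w * \<sigma>\<close> is the sum of \<open>f\<^sub>I\<close> over those \<open>\<tau>\<close> for which \<open>w * \<tau>\<close> is a multiple of \<open>w * \<sigma>\<close>, each with the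
  sign of this multiple.
\<close>

definition sign_functional :: "gen list \<Rightarrow> nat set \<Rightarrow> (gen list \<Rightarrow>\<^sub>0 'f::field) \<Rightarrow> 'f" where
  "sign_functional w I v = (\<Sum>\<sigma> | \<sigma> permutes {..<length w}.
     Poly_Mapping.lookup v (permute_list \<sigma> w) *
       (fsign (length w) (odd_positions w) \<sigma> * fsign (length w) I \<sigma>))"

lemma odd_positions_subset: "odd_positions w \<subseteq> {..<length w}"
  by (auto simp: odd_positions_def)

lemma sign_functional_add: "sign_functional w I (u + v) = sign_functional w I u + sign_functional w I v"
  by (simp add: sign_functional_def lookup_add algebra_simps sum.distrib)

lemma sign_functional_scale: "sign_functional w I (pscale c v) = c * sign_functional w I v"
  by (simp add: sign_functional_def sum_distrib_left mult_ac)

lemma sign_functional_zero: "sign_functional w I 0 = 0"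
  by (simp add: sign_functional_def)

lemma sign_functional_sum: "sign_functional w I (sum f A) = (\<Sum>x\<in>A. sign_functional w I (f x))"
  by (induction A rule: infinite_finite_induct) (simp_all add: sign_functional_add sign_functional_zero)

lemma subspace_content_space: "pm.subspace (content_space w :: (gen list \<Rightarrow>\<^sub>0 'f::field) set)"
proof (rule pm.subspaceI)
  fix u v :: "gen list \<Rightarrow>\<^sub>0 'f" and c :: 'f
  show "0 \<in> content_space w" by (simp add: content_space_def)
  show "u + v \<in> content_space w" if "u \<in> content_space w" "v \<in> content_space w"
    using that keys_add[of u v] by (auto simp: content_space_def)
  show "pscale c u \<in> content_space w" if "u \<in> content_space w"
    using that by (auto simp: content_space_def in_keys_iff)
qed

lemma single_content_space: "mset u = mset w \<Longrightarrow> Poly_Mapping.single u c \<in> content_space w"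
  by (auto simp: content_space_def)

lemma content_space_length: "v \<in> content_space w \<Longrightarrow> u \<in> Poly_Mapping.keys v \<Longrightarrow> length u = length w"
  unfolding content_space_def by (auto dest: mset_eq_length)

lemma permute_list_cancel:
  assumes "\<tau> permutes {..<n}" "length u = n" "length v = n" "permute_list \<tau> u = permute_list \<tau> v"
  shows "u = v"
proof -
  have "permute_list (inv \<tau>) (permute_list \<tau> x) = x" if "length x = n" for x :: "'a list"
    using permute_list_compose[of "inv \<tau>" x \<tau>] permutes_inv[OF assms(1)] that
      permutes_inv_o(1)[OF assms(1)] by simp
  then show ?thesis using assms by metis
qed

lemma lookup_perm_act:
  fixes w :: "gen list" and v :: "gen list \<Rightarrow>\<^sub>0 'f::field"
  defines "n \<equiv> length w"
  assumes v: "v \<in> content_space w" and \<rho>: "\<rho> permutes {..<n}" and \<tau>: "\<tau> permutes {..<n}"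
  shows "Poly_Mapping.lookup (perm_act n v \<tau>) (permute_list (\<rho> \<circ> \<tau>) w) =
    Poly_Mapping.lookup v (permute_list \<rho> w) * fsign n (pull n \<rho> (odd_positions w)) \<tau>"
proof -
  let ?u = "permute_list \<rho> w"
  have comp: "permute_list (\<rho> \<circ> \<tau>) w = permute_list \<tau> ?u"
    using permute_list_compose[of \<tau> w \<rho>] \<tau> by (simp add: n_def)
  have odd: "{i. i < n \<and> ?u ! i \<in> range Z} = pull n \<rho> (odd_positions w)"
    using permute_list_nth[of \<rho> w] \<rho> permutes_in_image[OF \<rho>] by (auto simp: n_def odd_positions_def)
  have "Poly_Mapping.lookup (perm_act n v \<tau>) (permute_list (\<rho> \<circ> \<tau>) w) =
      (\<Sum>u\<in>Poly_Mapping.keys v. if u = ?u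
        then Poly_Mapping.lookup v ?u * fsign n (pull n \<rho> (odd_positions w)) \<tau> else 0)"
    unfolding perm_act_def lookup_sum
  proof (rule sum.cong[OF refl])
    fix u assume "u \<in> Poly_Mapping.keys v"
    then have len: "length u = n" using content_space_length[OF v] by (simp add: n_def)
    have "map (\<lambda>i. u ! \<tau> i) [0..<n] = permute_list \<tau> u" by (simp add: permute_list_def len)
    moreover have "permute_list \<tau> u = permute_list \<tau> ?u \<longleftrightarrow> u = ?u"
      using permute_list_cancel[OF \<tau> len, of ?u] by (auto simp: n_def)
    ultimately show "Poly_Mapping.lookup (Poly_Mapping.single (map (\<lambda>i. u ! \<tau> i) [0..<n])
          (Poly_Mapping.lookup v u * fsign n {i. i < n \<and> u ! i \<in> range Z} \<tau>))
          (permute_list (\<rho> \<circ> \<tau>) w) =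
        (if u = ?u then Poly_Mapping.lookup v ?u * fsign n (pull n \<rho> (odd_positions w)) \<tau> else 0)"
      using odd by (auto simp: lookup_single comp when_def)
  qed
  also have "\<dots> = Poly_Mapping.lookup v ?u * fsign n (pull n \<rho> (odd_positions w)) \<tau>"
    by (simp add: in_keys_iff)
  finally show ?thesis .
qed

lemma perm_act_content_space:
  assumes v: "v \<in> content_space w" and \<tau>: "\<tau> permutes {..<length w}"
  shows "perm_act (length w) v \<tau> \<in> content_space w"
  unfolding perm_act_def
proof (intro pm.subspace_sum[OF subspace_content_space] single_content_space)
  fix u assume u: "u \<in> Poly_Mapping.keys v"
  then have len: "length u = length w" using content_space_length[OF v] by blast
  have "map (\<lambda>i. u ! \<tau> i) [0..<length w] = permute_list \<tau> u" by (simp add: permute_list_def len)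
  then show "mset (map (\<lambda>i. u ! \<tau> i) [0..<length w]) = mset w"
    using u v \<tau> len by (simp add: content_space_def)
qed

lemma poly_act_content_space:
  assumes "v \<in> content_space w"
  shows "poly_act (length w) v q \<in> content_space w"
  unfolding poly_act_def
  by (intro pm.subspace_sum pm.subspace_scale subspace_content_space perm_act_content_space assms) auto

text \<open>
  Substituting \<open>\<sigma> = \<rho> \<circ> \<tau>\<close> and using the cocycle rule for both signs, the sum over \<open>\<tau>\<close> becomes, for
  each fixed \<open>\<rho>\<close>, one of the linear forms that vanish on \<open>q\<close>.
\<close>

lemma sign_functional_poly_act:
  fixes v :: "gen list \<Rightarrow>\<^sub>0 'f::field"
  assumes v: "v \<in> content_space w" and q: "q \<in> multilinear_identities gscale (length w)"
    and I: "I \<subseteq> {..<length w}"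
  shows "sign_functional w I (poly_act (length w) v q) = 0"
proof -
  let ?n = "length w" and ?J = "odd_positions w"
  let ?P = "{\<sigma>. \<sigma> permutes {..<?n}}"
  let ?q = "\<lambda>\<tau>. Poly_Mapping.lookup q (arrangement ?n \<tau>)"
  let ?g = "\<lambda>\<rho>. Poly_Mapping.lookup v (permute_list \<rho> w) * (fsign ?n ?J \<rho> * fsign ?n I \<rho>)"
  have act: "sign_functional w I (perm_act ?n v \<tau>) = (\<Sum>\<rho>\<in>?P. ?g \<rho> * fsign ?n (pull ?n \<rho> I) \<tau>)"
    if \<tau>: "\<tau> permutes {..<?n}" for \<tau>
  proof -
    have "sign_functional w I (perm_act ?n v \<tau>) =
        (\<Sum>\<rho>\<in>?P. Poly_Mapping.lookup (perm_act ?n v \<tau>) (permute_list (\<rho> \<circ> \<tau>) w) *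
          (fsign ?n ?J (\<rho> \<circ> \<tau>) * fsign ?n I (\<rho> \<circ> \<tau>)))"
      unfolding sign_functional_def by (rule sum_permutations_compose_right[OF \<tau>])
    also have "\<dots> = (\<Sum>\<rho>\<in>?P. ?g \<rho> * fsign ?n (pull ?n \<rho> I) \<tau>)"
    proof (rule sum.cong[OF refl])
      fix \<rho> assume "\<rho> \<in> ?P"
      then have \<rho>: "\<rho> permutes {..<?n}" by simp
      let ?s = "fsign ?n (pull ?n \<rho> ?J) \<tau> :: 'f"
      have "?s * ?s = 1" using fsign_square[OF \<tau>, of "pull ?n \<rho> ?J"] by auto
      then have "?s * (?s * x) = x" for x by (simp flip: mult.assoc)
      then show "Poly_Mapping.lookup (perm_act ?n v \<tau>) (permute_list (\<rho> \<circ> \<tau>) w) *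
          (fsign ?n ?J (\<rho> \<circ> \<tau>) * fsign ?n I (\<rho> \<circ> \<tau>)) = ?g \<rho> * fsign ?n (pull ?n \<rho> I) \<tau>"
        using lookup_perm_act[OF v \<rho> \<tau>] fsign_compose[OF \<rho> \<tau> odd_positions_subset, where 'f = 'f]
          fsign_compose[OF \<rho> \<tau> I, where 'f = 'f]
        by (simp add: mult_ac)
    qed
    finally show ?thesis .
  qed
  have "sign_functional w I (poly_act ?n v q) =
      (\<Sum>\<tau>\<in>?P. ?q \<tau> * (\<Sum>\<rho>\<in>?P. ?g \<rho> * fsign ?n (pull ?n \<rho> I) \<tau>))"
    unfolding poly_act_def by (simp add: sign_functional_sum sign_functional_scale act)
  also have "\<dots> = (\<Sum>\<rho>\<in>?P. ?g \<rho> * (\<Sum>\<tau>\<in>?P. ?q \<tau> * fsign ?n (pull ?n \<rho> I) \<tau>))"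
    unfolding sum_distrib_left by (subst sum.swap) (simp add: mult_ac)
  also have "\<dots> = 0"
  proof (rule sum.neutral, rule ballI)
    fix \<rho>
    have "pull ?n \<rho> I \<subseteq> {..<?n}" by auto
    then have "(\<Sum>\<tau>\<in>?P. ?q \<tau> * fsign ?n (pull ?n \<rho> I) \<tau>) = 0"
      using q unfolding multilinear_identities_grassmann by blast
    then show "?g \<rho> * (\<Sum>\<tau>\<in>?P. ?q \<tau> * fsign ?n (pull ?n \<rho> I) \<tau>) = 0" by simp
  qed
  finally show ?thesis .
qed

definition stabilizer :: "'a list \<Rightarrow> (nat \<Rightarrow> nat) set" where
  "stabilizer w = {\<gamma>. \<gamma> permutes {..<length w} \<and> permute_list \<gamma> w = w}"

lemma finite_stabilizer: "finite (stabilizer w)"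
  by (rule finite_subset[of _ "{\<gamma>. \<gamma> permutes {..<length w}}"])
    (auto simp: stabilizer_def finite_permutations)

lemma id_in_stabilizer: "id \<in> stabilizer w"
  by (simp add: stabilizer_def permutes_id)

lemma bij_betw_stabilizer_coset:
  assumes \<rho>: "\<rho> permutes {..<length w}"
  shows "bij_betw (\<lambda>\<gamma>. \<gamma> \<circ> \<rho>) (stabilizer w)
    {\<sigma>. \<sigma> permutes {..<length w} \<and> permute_list \<sigma> w = permute_list \<rho> w}"
proof (rule bij_betw_byWitness[where f' = "\<lambda>\<sigma>. \<sigma> \<circ> inv \<rho>"])
  have inv: "inv \<rho> \<circ> \<rho> = id" "\<rho> \<circ> inv \<rho> = id" using permutes_inv_o[OF \<rho>] by auto
  show "\<forall>\<gamma>\<in>stabilizer w. \<gamma> \<circ> \<rho> \<circ> inv \<rho> = \<gamma>" by (simp add: comp_assoc inv)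
  show "\<forall>\<sigma>\<in>{\<sigma>. \<sigma> permutes {..<length w} \<and> permute_list \<sigma> w = permute_list \<rho> w}.
      \<sigma> \<circ> inv \<rho> \<circ> \<rho> = \<sigma>" by (simp add: comp_assoc inv)
  show "(\<lambda>\<gamma>. \<gamma> \<circ> \<rho>) ` stabilizer w \<subseteq>
      {\<sigma>. \<sigma> permutes {..<length w} \<and> permute_list \<sigma> w = permute_list \<rho> w}"
    using \<rho> by (auto simp: stabilizer_def permute_list_compose intro: permutes_compose)
  have i: "inv \<rho> permutes {..<length w}" using permutes_inv[OF \<rho>] .
  show "(\<lambda>\<sigma>. \<sigma> \<circ> inv \<rho>) `
      {\<sigma>. \<sigma> permutes {..<length w} \<and> permute_list \<sigma> w = permute_list \<rho> w} \<subseteq> stabilizer w"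
  proof
    fix \<tau> assume "\<tau> \<in> (\<lambda>\<sigma>. \<sigma> \<circ> inv \<rho>) `
      {\<sigma>. \<sigma> permutes {..<length w} \<and> permute_list \<sigma> w = permute_list \<rho> w}"
    then obtain \<sigma> where \<sigma>: "\<tau> = \<sigma> \<circ> inv \<rho>" "\<sigma> permutes {..<length w}"
      "permute_list \<sigma> w = permute_list \<rho> w" by auto
    have "permute_list \<tau> w = permute_list (\<rho> \<circ> inv \<rho>) w"
      using permute_list_compose[OF i] \<sigma>(1,3) by metis
    then show "\<tau> \<in> stabilizer w"
      using permutes_compose[OF i \<sigma>(2)] \<sigma>(1) inv by (simp add: stabilizer_def)
  qed
qed

text \<open>
  For the inclusion from right to left, \<open>v\<close> is lifted to the polynomial \<open>q\<close> with coefficients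
  \<open>v(w\<sigma>) f\<^sub>J(\<sigma>)\<close>. The linear forms that define the identities take the values \<open>\<Phi>\<^sub>I(v) = 0\<close> at \<open>q\<close>, and
  \<open>w * q\<close> is \<open>v\<close> multiplied by the order of the stabilizer, which is invertible in
  characteristic \<open>0\<close>.
\<close>

lemma span_poly_act_identities:
  fixes w :: "gen list"
  shows "pm.span {poly_act (length w) v q | v q.
        v \<in> content_space w \<and> q \<in> multilinear_identities (gscale :: 'f \<Rightarrow> _) (length w)} =
    {v \<in> content_space w. \<forall>I\<subseteq>{..<length w}. sign_functional w I v = (0 :: 'f::field_char_0)}"
    (is "pm.span ?G = ?R")
proof
  let ?n = "length w" and ?J = "odd_positions w"
  let ?P = "{\<sigma>. \<sigma> permutes {..<?n}}"
  show "pm.span ?G \<subseteq> ?R"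
  proof (rule pm.span_minimal)
    show "?G \<subseteq> ?R" using poly_act_content_space sign_functional_poly_act by blast
    show "pm.subspace ?R"
      using subspace_content_space[of w, where 'f = 'f]
      by (auto simp: pm.subspace_def sign_functional_add sign_functional_scale sign_functional_zero)
  qed
  show "?R \<subseteq> pm.span ?G"
  proof
    fix v assume v: "v \<in> ?R"
    let ?v = "\<lambda>\<sigma>. Poly_Mapping.lookup v (permute_list \<sigma> w)"
    define q where "q = (\<Sum>\<sigma>\<in>?P. Poly_Mapping.single (arrangement ?n \<sigma>) (?v \<sigma> * fsign ?n ?J \<sigma>))"
    have finP: "finite ?P" by (simp add: finite_permutations)
    have lq: "Poly_Mapping.lookup q (arrangement ?n \<tau>) = ?v \<tau> * fsign ?n ?J \<tau>"
      if \<tau>: "\<tau> permutes {..<?n}" for \<tau>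
    proof -
      have "Poly_Mapping.lookup q (arrangement ?n \<tau>) =
          (\<Sum>\<sigma>\<in>?P. if \<sigma> = \<tau> then ?v \<tau> * fsign ?n ?J \<tau> else 0)"
        unfolding q_def lookup_sum lookup_single
        by (rule sum.cong) (use \<tau> arrangement_inject in \<open>auto simp: when_def simp del: map_eq_conv\<close>)
      then show ?thesis using finP \<tau> by simp
    qed
    have "q \<in> multilinear_polys ?n"
    proof -
      have "Poly_Mapping.keys q \<subseteq> (\<Union>\<sigma>\<in>?P. {arrangement ?n \<sigma>})"
        unfolding q_def by (rule order_trans[OF keys_sum]) auto
      then show ?thesis by (auto simp: multilinear_polys_def)
    qed
    then have qQ: "q \<in> multilinear_identities gscale ?n"
      using v unfolding multilinear_identities_grassmann
      by (auto simp: sign_functional_def lq mult.assoc)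
    let ?m = "of_nat (card (stabilizer w)) :: 'f"
    have m: "?m \<noteq> 0"
      using finite_stabilizer[of w] id_in_stabilizer[of w] by (auto simp: card_eq_0_iff)
    have "poly_act ?n (Poly_Mapping.single w 1) q = pscale ?m v"
    proof (rule poly_mapping_eqI)
      fix u
      have "Poly_Mapping.lookup (poly_act ?n (Poly_Mapping.single w 1) q) u =
          (\<Sum>\<sigma>\<in>?P. if permute_list \<sigma> w = u then Poly_Mapping.lookup v u else 0)"
        unfolding poly_act_def lookup_sum lookup_pscale
      proof (rule sum.cong[OF refl])
        fix \<sigma> assume "\<sigma> \<in> ?P"
        then have \<sigma>: "\<sigma> permutes {..<?n}" by simp
        have "fsign ?n ?J \<sigma> * fsign ?n ?J \<sigma> = (1 :: 'f)"
          by (rule fsign_square[OF \<sigma> odd_positions_subset])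
        then show "Poly_Mapping.lookup q (arrangement ?n \<sigma>) *
            Poly_Mapping.lookup (perm_act ?n (Poly_Mapping.single w 1) \<sigma>) u =
            (if permute_list \<sigma> w = u then Poly_Mapping.lookup v u else 0)"
          by (auto simp: lq[OF \<sigma>] perm_act_def lookup_single when_def permute_list_def
              odd_positions_def mult.assoc)
      qed
      also have "\<dots> = of_nat (card {\<sigma> \<in> ?P. permute_list \<sigma> w = u}) * Poly_Mapping.lookup v u"
        using finP by (simp add: sum.If_cases Int_def)
      also have "\<dots> = ?m * Poly_Mapping.lookup v u"
      proof (cases "u \<in> Poly_Mapping.keys v")
        case True
        then have "mset u = mset w" using v by (auto simp: content_space_def)
        then obtain \<rho> where \<rho>: "\<rho> permutes {..<?n}" "permute_list \<rho> w = u"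
          by (rule mset_eq_permutation)
        have "card (stabilizer w) = card {\<sigma> \<in> ?P. permute_list \<sigma> w = u}"
          using bij_betw_same_card[OF bij_betw_stabilizer_coset[OF \<rho>(1)]] \<rho>(2) by simp
        then show ?thesis by simp
      qed (simp add: in_keys_iff)
      finally show "Poly_Mapping.lookup (poly_act ?n (Poly_Mapping.single w 1) q) u =
          Poly_Mapping.lookup (pscale ?m v) u" by simp
    qed
    moreover have "poly_act ?n (Poly_Mapping.single w 1) q \<in> pm.span ?G"
      using qQ single_content_space[of w w] by (intro pm.span_base) blast
    ultimately have "pscale ?m v \<in> pm.span ?G" by simp
    then have "pscale (1 / ?m) (pscale ?m v) \<in> pm.span ?G" by (rule pm.span_scale)
    then show "v \<in> pm.span ?G" using m by simp
  qed
qed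

section \<open>Independent functionals\<close>

text \<open>
  Induction on the number of functionals: by independence the new functional is not the
  combination of the others that agrees with it on the old dual vectors. A vector on which the two
  differ is corrected to one that the others annihilate, and then the old dual vectors are
  corrected by multiples of it.
\<close>

lemma dual_vectors_exist:
  fixes \<phi> :: "'s \<Rightarrow> ('w \<Rightarrow>\<^sub>0 'f::field) \<Rightarrow> 'f"
  assumes V: "pm.subspace V"
    and add: "\<And>s u v. \<phi> s (u + v) = \<phi> s u + \<phi> s v"
    and scale: "\<And>s c v. \<phi> s (pscale c v) = c * \<phi> s v"
    and "finite N"
    and "\<And>c. (\<forall>v\<in>V. (\<Sum>s\<in>N. c s * \<phi> s v) = 0) \<Longrightarrow> \<forall>s\<in>N. c s = 0"
  shows "\<exists>b. \<forall>s\<in>N. b s \<in> V \<and> (\<forall>t\<in>N. \<phi> t (b s) = (if t = s then 1 else 0))"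
  using assms(4,5)
proof (induction N rule: finite_induct)
  case (insert s N)
  have zero: "\<phi> r 0 = 0" for r using scale[of r 0 0] by simp
  have sum: "\<phi> r (sum f A) = (\<Sum>x\<in>A. \<phi> r (f x))" for r f and A :: "'s set"
    by (induction A rule: infinite_finite_induct) (simp_all add: add zero)
  have diff: "\<phi> r (u - v) = \<phi> r u - \<phi> r v" for r u v
    using add[of r "u - v" v] by simp
  have "\<forall>t\<in>N. c t = 0" if "\<forall>v\<in>V. (\<Sum>t\<in>N. c t * \<phi> t v) = 0" for c
  proof -
    have "(\<Sum>t\<in>insert s N. (c(s := 0)) t * \<phi> t v) = (\<Sum>t\<in>N. c t * \<phi> t v)" for v
      using insert.hyps by (auto intro!: sum.cong)
    then have "\<forall>t\<in>insert s N. (c(s := 0)) t = 0"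
      using that by (intro insert.prems) auto
    then show ?thesis using insert.hyps(2) by (auto split: if_splits)
  qed
  then obtain b where bV: "\<And>t. t \<in> N \<Longrightarrow> b t \<in> V"
    and b: "\<And>r t. r \<in> N \<Longrightarrow> t \<in> N \<Longrightarrow> \<phi> r (b t) = (if r = t then 1 else 0)"
    using insert.IH by blast
  \<comment> \<open>the new functional minus the combination of the old ones that agrees with it on all \<open>b t\<close>\<close>
  define c where "c t = (if t = s then 1 else - \<phi> s (b t))" for t
  have "\<not> (\<forall>t\<in>insert s N. c t = 0)" by (simp add: c_def)
  then obtain u where u: "u \<in> V" "(\<Sum>t\<in>insert s N. c t * \<phi> t u) \<noteq> 0"
    using insert.prems by blast
  define \<delta> where "\<delta> = \<phi> s u - (\<Sum>t\<in>N. \<phi> t u * \<phi> s (b t))"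
  have "(\<Sum>t\<in>N. c t * \<phi> t u) = - (\<Sum>t\<in>N. \<phi> t u * \<phi> s (b t))"
    unfolding sum_negf[symmetric] by (rule sum.cong) (use insert.hyps in \<open>auto simp: c_def\<close>)
  then have \<delta>: "\<delta> \<noteq> 0" using u(2) insert.hyps by (simp add: \<delta>_def c_def)
  define x where "x = pscale (1 / \<delta>) (u - (\<Sum>t\<in>N. pscale (\<phi> t u) (b t)))"
  have xV: "x \<in> V"
    unfolding x_def using u bV V
    by (intro pm.subspace_scale pm.subspace_diff pm.subspace_sum) auto
  have xs: "\<phi> s x = 1" using \<delta> by (simp add: x_def scale diff sum \<delta>_def)
  have xr: "\<phi> r x = 0" if "r \<in> N" for r
  proof -
    have "(\<Sum>t\<in>N. \<phi> t u * \<phi> r (b t)) = (\<Sum>t\<in>N. if t = r then \<phi> r u else 0)"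
      by (rule sum.cong) (use b that in auto)
    then show ?thesis using that insert.hyps by (simp add: x_def scale diff sum)
  qed
  show ?case
  proof (intro exI[of _ "\<lambda>t. if t = s then x else b t - pscale (\<phi> s (b t)) x"] ballI conjI)
    fix t assume t: "t \<in> insert s N"
    show "(if t = s then x else b t - pscale (\<phi> s (b t)) x) \<in> V"
      using t xV bV V by (auto intro: pm.subspace_diff pm.subspace_scale)
    fix r assume r: "r \<in> insert s N"
    show "\<phi> r (if t = s then x else b t - pscale (\<phi> s (b t)) x) = (if r = t then 1 else 0)"
      using t r b xs xr insert.hyps(2) by (auto simp: diff scale)
  qed
qed simp

lemma quotient_dim_eq_card:
  fixes \<phi> :: "'s \<Rightarrow> ('w \<Rightarrow>\<^sub>0 'f::field) \<Rightarrow> 'f"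
  assumes V: "pm.subspace V" "finite F" "V \<subseteq> pm.span F"
    and add: "\<And>s u v. \<phi> s (u + v) = \<phi> s u + \<phi> s v"
    and scale: "\<And>s c v. \<phi> s (pscale c v) = c * \<phi> s v"
    and N: "finite N"
    and ind: "\<And>c. (\<forall>v\<in>V. (\<Sum>s\<in>N. c s * \<phi> s v) = 0) \<Longrightarrow> \<forall>s\<in>N. c s = 0"
  shows "quotient_dim V {v \<in> V. \<forall>s\<in>N. \<phi> s v = 0} = card N"
proof -
  let ?W = "{v \<in> V. \<forall>s\<in>N. \<phi> s v = 0}"
  have zero: "\<phi> r 0 = 0" for r using scale[of r 0 0] by simp
  have sum: "\<phi> r (sum f A) = (\<Sum>x\<in>A. \<phi> r (f x))" for r f and A :: "'x set"
    by (induction A rule: infinite_finite_induct) (simp_all add: add zero)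
  have diff: "\<phi> r (u - v) = \<phi> r u - \<phi> r v" for r u v
    using add[of r "u - v" v] by simp
  have W: "pm.subspace ?W" "?W \<subseteq> V"
    using V(1) by (auto simp: pm.subspace_def add scale zero)
  obtain b where bV: "\<And>t. t \<in> N \<Longrightarrow> b t \<in> V"
    and b: "\<And>r t. r \<in> N \<Longrightarrow> t \<in> N \<Longrightarrow> \<phi> r (b t) = (if r = t then 1 else 0)"
    using dual_vectors_exist[where \<phi> = \<phi>, OF V(1) add scale N ind] by blast
  have inj: "inj_on b N"
  proof (rule inj_onI)
    fix s t assume st: "s \<in> N" "t \<in> N" "b s = b t"
    then have "\<phi> s (b s) = \<phi> s (b t)" by simp
    then show "s = t" using b[OF st(1,1)] b[OF st(1,2)] by (auto split: if_splits)
  qed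
  have "quotient_basis V ?W (b ` N)"
    unfolding quotient_basis_def
  proof (intro conjI allI impI ballI)
    show "b ` N \<subseteq> V" using bV by auto
  next
    fix S c x assume S: "finite S \<and> S \<subseteq> b ` N \<and> (\<Sum>y\<in>S. pscale (c y) y) \<in> ?W" and x: "x \<in> S"
    then obtain s where s: "s \<in> N" "x = b s" by auto
    have "0 = \<phi> s (\<Sum>y\<in>S. pscale (c y) y)" using S s by simp
    also have "\<dots> = (\<Sum>y\<in>S. c y * \<phi> s y)" by (simp add: sum scale)
    also have "\<dots> = (\<Sum>y\<in>S. if y = x then c x else 0)"
    proof (rule sum.cong[OF refl])
      fix y assume "y \<in> S"
      then obtain t where "t \<in> N" "y = b t" using S by auto
      then show "c y * \<phi> s y = (if y = x then c x else 0)"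
        using s b inj by (auto dest: inj_onD)
    qed
    also have "\<dots> = c x" using S x by simp
    finally show "c x = 0" by simp
  next
    fix v assume v: "v \<in> V"
    let ?u = "\<Sum>s\<in>N. pscale (\<phi> s v) (b s)"
    have u: "?u \<in> pm.span (b ` N)"
      by (intro pm.span_sum pm.span_scale pm.span_base) auto
    have "v - ?u \<in> V"
      using v bV V(1) by (intro pm.subspace_diff pm.subspace_sum pm.subspace_scale) auto
    moreover have "\<phi> r (v - ?u) = 0" if "r \<in> N" for r
    proof -
      have "(\<Sum>t\<in>N. \<phi> t v * \<phi> r (b t)) = (\<Sum>t\<in>N. if t = r then \<phi> r v else 0)"
        by (rule sum.cong) (use b that in auto)
      then show ?thesis using that N by (simp add: scale diff sum)
    qed
    ultimately show "\<exists>u\<in>pm.span (b ` N). v - u \<in> ?W" using u by blast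
  qed
  from quotient_basis_card[OF V(1) W V(2,3) this] quotient_dim[OF V(1) W V(2,3)]
  show ?thesis using card_image[OF inj] by simp
qed

section \<open>Sign functionals up to letter-preserving permutations\<close>

lemma stabilizer_nth: "\<gamma> \<in> stabilizer w \<Longrightarrow> i < length w \<Longrightarrow> w ! \<gamma> i = w ! i"
  using permute_list_nth[of \<gamma> w i] by (simp add: stabilizer_def)

lemma stabilizerI:
  assumes "\<gamma> permutes {..<length w}" "\<And>i. i < length w \<Longrightarrow> w ! \<gamma> i = w ! i"
  shows "\<gamma> \<in> stabilizer w"
  using assms by (auto simp: stabilizer_def permute_list_nth intro!: nth_equalityI)

lemma pull_odd_positions: "\<gamma> \<in> stabilizer w \<Longrightarrow> pull (length w) \<gamma> (odd_positions w) = odd_positions w"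
  using stabilizer_nth[of \<gamma> w] permutes_in_image[of \<gamma> "{..<length w}"]
  by (auto simp: odd_positions_def stabilizer_def)

text \<open>
  Replacing \<open>\<sigma>\<close> by \<open>\<gamma> \<circ> \<sigma>\<close> leaves the rearranged word unchanged and moves \<open>I\<close> to its preimage under \<open>\<gamma>\<close>.
\<close>

lemma sign_functional_stabilizer:
  fixes v :: "gen list \<Rightarrow>\<^sub>0 'f::field"
  assumes \<gamma>: "\<gamma> \<in> stabilizer w" and I: "I \<subseteq> {..<length w}"
  shows "sign_functional w I v =
    fsign (length w) (odd_positions w) \<gamma> * fsign (length w) I \<gamma> * sign_functional w (pull (length w) \<gamma> I) v"
proof -
  let ?n = "length w"
  have g: "\<gamma> permutes {..<?n}" "permute_list \<gamma> w = w" using \<gamma> by (auto simp: stabilizer_def)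
  show ?thesis
    unfolding sign_functional_def sum_distrib_left
  proof (subst setum_permutations_compose_left[OF g(1)], rule sum.cong[OF refl])
    fix \<sigma> assume "\<sigma> \<in> {\<sigma>. \<sigma> permutes {..<?n}}"
    then have \<sigma>: "\<sigma> permutes {..<?n}" by simp
    show "Poly_Mapping.lookup v (permute_list (\<gamma> \<circ> \<sigma>) w) *
        (fsign ?n (odd_positions w) (\<gamma> \<circ> \<sigma>) * fsign ?n I (\<gamma> \<circ> \<sigma>)) =
      fsign ?n (odd_positions w) \<gamma> * fsign ?n I \<gamma> *
        (Poly_Mapping.lookup v (permute_list \<sigma> w) *
          (fsign ?n (odd_positions w) \<sigma> * fsign ?n (pull ?n \<gamma> I) \<sigma>))"
      using permute_list_compose[OF \<sigma>, of \<gamma>] g(2) pull_odd_positions[OF \<gamma>]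
        fsign_compose[OF g(1) \<sigma> odd_positions_subset, where 'f = 'f]
        fsign_compose[OF g(1) \<sigma> I, where 'f = 'f]
      by simp
  qed
qed

lemma fsign_fixes:
  assumes "\<gamma> permutes {..<n}" "I \<subseteq> {..<n}" "\<And>i. i \<in> I \<Longrightarrow> \<gamma> i = i"
  shows "fsign n I \<gamma> = (1 :: 'f::field)"
proof -
  have "pull n \<gamma> I = I"
  proof (intro set_eqI iffI)
    fix i assume "i \<in> pull n \<gamma> I"
    then have "\<gamma> (\<gamma> i) = \<gamma> i" "\<gamma> i \<in> I" using assms(3) by auto
    then show "i \<in> I" using permutes_inj[OF assms(1)] by (metis injD)
  qed (use assms in auto)
  moreover have "(\<lambda>i. if i \<in> I then \<gamma> i else i) = id" using assms(3) by auto
  ultimately show ?thesis using fsign_eq_sign[OF assms(1,2), where 'f = 'f] by simp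
qed

text \<open>
  Passing from \<open>D\<close> to the symmetric difference with \<open>J\<close> treats both kinds of letters alike: an
  \<open>x\<close>-letter can only occur once inside \<open>I\<close> and a \<open>z\<close>-letter only once outside \<open>I\<close> if \<open>\<Phi>\<^sub>I\<close> is
  nonzero, and both conditions say that the letter occurs at most once in \<open>D\<close>.
\<close>

definition twist :: "gen list \<Rightarrow> nat set \<Rightarrow> nat set" where
  "twist w D = sym_diff D (odd_positions w)"

lemma twist_subset: "D \<subseteq> {..<length w} \<Longrightarrow> twist w D \<subseteq> {..<length w}"
  using odd_positions_subset[of w] by (auto simp: twist_def)

lemma twist_twist [simp]: "twist w (twist w D) = D"
  by (auto simp: twist_def)

lemma card_sym_diff_parity:
  "finite A \<Longrightarrow> finite B \<Longrightarrow> even (card (sym_diff A B)) \<longleftrightarrow> even (card A + card B)"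
proof -
  assume fin: "finite A" "finite B"
  have "card A = card (A - B) + card (A \<inter> B)" "card B = card (B - A) + card (A \<inter> B)"
    using fin by (metis card_Diff_subset_Int add.commute card_Int_Diff Int_commute)+
  moreover have "card (sym_diff A B) = card (A - B) + card (B - A)"
    using fin by (intro card_Un_disjoint) auto
  ultimately show ?thesis by presburger
qed

lemma even_card_twist:
  assumes "D \<subseteq> {..<length w}"
  shows "even (card (twist w D)) \<longleftrightarrow> even (card D + card (odd_positions w))"
  unfolding twist_def using assms odd_positions_subset[of w]
  by (intro card_sym_diff_parity) (auto intro: finite_subset)

lemma pull_twist:
  assumes "\<gamma> \<in> stabilizer w"
  shows "pull (length w) \<gamma> (twist w D) = twist w (pull (length w) \<gamma> D)"
proof -
  have "\<gamma> i \<in> odd_positions w \<longleftrightarrow> i \<in> odd_positions w" if "i < length w" for i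
    using pull_odd_positions[OF assms] that by blast
  then show ?thesis using odd_positions_subset[of w] by (auto simp: twist_def)
qed

text \<open>
  The transposition \<open>\<tau>\<close> of the two positions fixes the word and the set. Both positions are in \<open>J\<close> and
  outside \<open>I\<close>, or both are in \<open>I\<close> and outside \<open>J\<close>, so exactly one of the signs \<open>f\<^sub>J(\<tau>)\<close> and \<open>f\<^sub>I(\<tau>)\<close>
  is \<open>-1\<close>, and the functional equals its negative.
\<close>

lemma sign_functional_repeated_letter:
  fixes v :: "gen list \<Rightarrow>\<^sub>0 'f::field_char_0"
  assumes D: "D \<subseteq> {..<length w}" and pq: "p \<in> D" "q \<in> D" "p \<noteq> q" "w ! p = w ! q"
  shows "sign_functional w (twist w D) v = 0"
proof -
  let ?n = "length w" and ?t = "transpose p q" and ?J = "odd_positions w"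
  have lt: "p < ?n" "q < ?n" using D pq by auto
  have t: "?t permutes {..<?n}" using lt by (intro permutes_swap_id) auto
  then have stab: "?t \<in> stabilizer w"
    by (rule stabilizerI) (use pq in \<open>auto simp: transpose_def\<close>)
  have "pull ?n ?t D = D" using D pq by (auto simp: transpose_def split: if_splits)
  then have p: "pull ?n ?t (twist w D) = twist w D" by (simp add: pull_twist[OF stab])
  have J: "p \<in> ?J \<longleftrightarrow> q \<in> ?J" using lt pq by (auto simp: odd_positions_def)
  have "fsign ?n ?J ?t * fsign ?n (twist w D) ?t = (- 1 :: 'f)"
  proof (cases "p \<in> ?J")
    case True
    then have "fsign ?n (twist w D) ?t = (1 :: 'f)"
      using pq J by (intro fsign_fixes[OF t twist_subset[OF D]]) (auto simp: twist_def transpose_def)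
    then show ?thesis using True J fsign_transpose[OF _ _ pq(3) odd_positions_subset, where 'f = 'f] by simp
  next
    case False
    then have "fsign ?n ?J ?t = (1 :: 'f)"
      using J by (intro fsign_fixes[OF t odd_positions_subset]) (auto simp: transpose_def)
    moreover have "p \<in> twist w D" "q \<in> twist w D" using False J pq by (auto simp: twist_def)
    ultimately show ?thesis using fsign_transpose[OF _ _ pq(3) twist_subset[OF D], where 'f = 'f] by simp
  qed
  then have "sign_functional w (twist w D) v = - sign_functional w (twist w D) v"
    using sign_functional_stabilizer[OF stab twist_subset[OF D], of v] p by simp
  then show ?thesis by simp
qed

text \<open>
  For every letter in question, \<open>\<gamma>\<close> exchanges the position where it occurs in \<open>D\<close> with the one where
  it occurs in \<open>E\<close>.
\<close>

lemma stabilizer_transitive: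
  assumes D: "D \<subseteq> {..<length w}" "inj_on ((!) w) D" and E: "E \<subseteq> {..<length w}" "inj_on ((!) w) E"
    and eq: "(!) w ` D = (!) w ` E"
  obtains \<gamma> where "\<gamma> \<in> stabilizer w" "pull (length w) \<gamma> D = E"
proof
  let ?n = "length w"
  define S where "S = (!) w ` D"
  define d where "d = inv_into D ((!) w)"
  define e where "e = inv_into E ((!) w)"
  have d: "d g \<in> D" "w ! d g = g" if "g \<in> S" for g
    using that inv_into_into[of g "(!) w" D] f_inv_into_f[of g "(!) w" D] by (auto simp: S_def d_def)
  have e: "e g \<in> E" "w ! e g = g" if "g \<in> S" for g
    using that inv_into_into[of g "(!) w" E] f_inv_into_f[of g "(!) w" E] eq by (auto simp: S_def e_def)
  have di: "d (w ! i) = i" if "i \<in> D" for i using that D(2) by (simp add: d_def)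
  have ei: "e (w ! i) = i" if "i \<in> E" for i using that E(2) by (simp add: e_def)
  define \<gamma> where "\<gamma> i = (if i < ?n \<and> w ! i \<in> S then transpose (d (w ! i)) (e (w ! i)) i else i)" for i
  have lt: "\<gamma> i < ?n \<and> w ! \<gamma> i = w ! i" if "i < ?n" for i
    using that d[of "w ! i"] e[of "w ! i"] D(1) E(1) by (auto simp: \<gamma>_def transpose_def)
  have "\<gamma> (\<gamma> i) = i" for i
  proof (cases "i < ?n \<and> w ! i \<in> S")
    case True
    then have "\<gamma> i < ?n" "w ! \<gamma> i = w ! i" using lt by auto
    then have "\<gamma> (\<gamma> i) = transpose (d (w ! i)) (e (w ! i)) (\<gamma> i)" using True by (simp add: \<gamma>_def)
    then show ?thesis using True by (simp add: \<gamma>_def)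
  qed (auto simp: \<gamma>_def)
  then have "\<gamma> permutes {..<?n}"
    unfolding permutes_def by (metis \<gamma>_def lessThan_iff)
  then show "\<gamma> \<in> stabilizer w" by (rule stabilizerI) (use lt in blast)
  show "pull ?n \<gamma> D = E"
  proof (intro set_eqI iffI)
    fix i assume "i \<in> E"
    then have "i < ?n" "w ! i \<in> S" "e (w ! i) = i" using E(1) eq ei by (auto simp: S_def)
    then show "i \<in> pull ?n \<gamma> D" using d by (simp add: \<gamma>_def)
  next
    fix i assume "i \<in> pull ?n \<gamma> D"
    then have i: "i < ?n" "\<gamma> i \<in> D" by auto
    have S: "w ! i \<in> S" using lt[OF i(1)] i(2) by (auto simp: S_def intro: rev_image_eqI)
    have "\<gamma> i = d (w ! i)" using di[OF i(2)] lt[OF i(1)] by simp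
    then have "i = e (w ! i)" using i(1) S by (auto simp: \<gamma>_def transpose_def split: if_splits)
    then show "i \<in> E" using e[OF S] by simp
  qed
qed

text \<open>
  Such a \<open>\<gamma>\<close> fixes \<open>D\<close> pointwise because it preserves letters, which are distinct on \<open>D\<close>. Hence \<open>J\<close> and its symmetric difference
  with \<open>D\<close> differ only in fixed points of \<open>\<gamma>\<close>, and the two signs agree.
\<close>

lemma fsign_stabilizer_invariant:
  assumes \<gamma>: "\<gamma> \<in> stabilizer w" and D: "D \<subseteq> {..<length w}" "inj_on ((!) w) D"
    and fix_D: "pull (length w) \<gamma> D = D"
  shows "fsign (length w) (odd_positions w) \<gamma> * fsign (length w) (twist w D) \<gamma> = (1 :: 'f::field)"
proof -
  let ?n = "length w" and ?J = "odd_positions w"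
  have g: "\<gamma> permutes {..<?n}" using \<gamma> by (simp add: stabilizer_def)
  have fixed: "\<gamma> i = i" if "i \<in> D" for i
  proof -
    have "\<gamma> i \<in> D" using fix_D that by auto
    moreover have "w ! \<gamma> i = w ! i" using stabilizer_nth[OF \<gamma>] that D(1) by auto
    ultimately show ?thesis using D(2) that by (auto dest: inj_onD)
  qed
  have "(\<lambda>i. if i \<in> twist w D then \<gamma> i else i) = (\<lambda>i. if i \<in> ?J then \<gamma> i else i)"
    using fixed by (auto simp: twist_def fun_eq_iff)
  moreover have "pull ?n \<gamma> (twist w D) = twist w D" by (simp add: pull_twist[OF \<gamma>] fix_D)
  ultimately have "fsign ?n (twist w D) \<gamma> = (fsign ?n ?J \<gamma> :: 'f)"
    using fsign_eq_sign[OF g twist_subset[OF D(1)], where 'f = 'f]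
      fsign_eq_sign[OF g odd_positions_subset pull_odd_positions[OF \<gamma>], where 'f = 'f] by simp
  then show ?thesis using fsign_square[OF g odd_positions_subset] by metis
qed

section \<open>The dimension of the quotient\<close>

definition representatives :: "gen list \<Rightarrow> gen set \<Rightarrow> nat set" where
  "representatives w S = inv_into {..<length w} ((!) w) ` S"

text \<open>The parity condition says that \<open>twist w D\<close> has even size if \<open>D\<close> represents \<open>S\<close>.\<close>

definition letter_sets :: "gen list \<Rightarrow> gen set set" where
  "letter_sets w = {S. S \<subseteq> set w \<and> even (card S + card (odd_positions w))}"

lemma representatives:
  assumes "S \<subseteq> set w"
  shows "representatives w S \<subseteq> {..<length w}" "inj_on ((!) w) (representatives w S)"
    "(!) w ` representatives w S = S" "card (representatives w S) = card S"
proof -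
  let ?r = "inv_into {..<length w} ((!) w)"
  have w: "set w = (!) w ` {..<length w}" by (auto simp: set_conv_nth)
  have r: "?r g \<in> {..<length w}" "w ! ?r g = g" if "g \<in> S" for g
    using assms that inv_into_into[of g "(!) w" "{..<length w}"]
      f_inv_into_f[of g "(!) w" "{..<length w}"] unfolding w by blast+
  show "representatives w S \<subseteq> {..<length w}" using r by (auto simp: representatives_def)
  show "inj_on ((!) w) (representatives w S)"
    using r by (auto simp: representatives_def intro!: inj_onI)
  show "(!) w ` representatives w S = S"
    using r by (force simp: representatives_def)
  have "inj_on ?r S" by (rule inj_onI) (metis r(2))
  then show "card (representatives w S) = card S"
    unfolding representatives_def by (rule card_image)
qed

text \<open>
  The functionals indexed by sets of letters span all the others: those along odd sets reduce to even
  sets, and along an even set the functional is zero or, after applying the stabilizer,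
  up to sign one of the chosen ones.
\<close>

lemma sign_functionals_vanish:
  fixes v :: "gen list \<Rightarrow>\<^sub>0 'f::field_char_0"
  assumes zero: "\<And>S. S \<in> letter_sets w \<Longrightarrow> sign_functional w (twist w (representatives w S)) v = 0"
    and I: "I \<subseteq> {..<length w}"
  shows "sign_functional w I v = 0"
proof -
  let ?n = "length w"
  have even: "sign_functional w I v = 0" if I: "I \<subseteq> {..<?n}" "even (card I)" for I
  proof -
    define D where "D = twist w I"
    have D: "D \<subseteq> {..<?n}" "twist w D = I" using twist_subset[OF I(1)] by (simp_all add: D_def)
    show ?thesis
    proof (cases "inj_on ((!) w) D")
      case False
      then obtain p q where "p \<in> D" "q \<in> D" "p \<noteq> q" "w ! p = w ! q" by (auto simp: inj_on_def)
      from sign_functional_repeated_letter[OF D(1) this] show ?thesis by (simp add: D(2))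
    next
      case True
      define S where "S = (!) w ` D"
      have S: "S \<subseteq> set w" using D(1) by (auto simp: S_def)
      have "card S = card D" unfolding S_def using True by (rule card_image)
      then have SN: "S \<in> letter_sets w"
        using S even_card_twist[OF D(1)] D(2) I(2) by (simp add: letter_sets_def)
      note r = representatives[OF S]
      have "(!) w ` D = (!) w ` representatives w S" using r(3) by (simp add: S_def)
      from stabilizer_transitive[OF D(1) True r(1,2) this]
      obtain \<gamma> where \<gamma>: "\<gamma> \<in> stabilizer w" "pull ?n \<gamma> D = representatives w S" .
      have "pull ?n \<gamma> I = twist w (representatives w S)"
        using pull_twist[OF \<gamma>(1), of D] \<gamma>(2) D(2) by simp
      then show ?thesis
        using sign_functional_stabilizer[OF \<gamma>(1) I(1), of v] zero[OF SN] by simp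
    qed
  qed
  show ?thesis
  proof (cases "even (card I)")
    case False
    have "sign_functional w I v =
        (\<Sum>x\<in>I. (- 1) ^ card {y \<in> I. y < x} * sign_functional w (I - {x}) v)"
      unfolding sign_functional_def sum_distrib_left
      by (subst sum.swap, rule sum.cong[OF refl])
        (simp add: fsign_odd_expansion[OF _ I False] sum_distrib_left mult_ac)
    also have "\<dots> = 0"
    proof (rule sum.neutral, rule ballI)
      fix x assume "x \<in> I"
      have "finite I" using I finite_subset by blast
      then have "even (card (I - {x}))" using False \<open>x \<in> I\<close> by simp
      moreover have "I - {x} \<subseteq> {..<?n}" using I by auto
      ultimately show "(- 1) ^ card {y \<in> I. y < x} * sign_functional w (I - {x}) v = 0"
        using even by simp
    qed
    finally show ?thesis .
  qed (use even I in blast)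
qed

lemma sign_functional_single:
  assumes \<rho>: "\<rho> permutes {..<length w}" and I: "I \<subseteq> {..<length w}"
  shows "sign_functional w I (Poly_Mapping.single (permute_list \<rho> w) (1 :: 'f::field)) =
    fsign (length w) (odd_positions w) \<rho> * (\<Sum>\<gamma>\<in>stabilizer w.
      fsign (length w) (odd_positions w) \<gamma> * fsign (length w) I \<gamma> *
      fsign (length w) (pull (length w) \<gamma> I) \<rho>)"
proof -
  let ?n = "length w" and ?J = "odd_positions w"
  let ?P = "{\<sigma>. \<sigma> permutes {..<?n}}"
  let ?f = "\<lambda>\<sigma>. fsign ?n ?J \<sigma> * fsign ?n I \<sigma> :: 'f"
  have "sign_functional w I (Poly_Mapping.single (permute_list \<rho> w) 1) =
      (\<Sum>\<sigma>\<in>?P. if permute_list \<sigma> w = permute_list \<rho> w then ?f \<sigma> else 0)"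
    unfolding sign_functional_def by (rule sum.cong) (auto simp: lookup_single when_def)
  also have "\<dots> = sum ?f {\<sigma>. \<sigma> permutes {..<?n} \<and> permute_list \<sigma> w = permute_list \<rho> w}"
    by (simp add: sum.If_cases finite_permutations Int_def)
  also have "\<dots> = (\<Sum>\<gamma>\<in>stabilizer w. ?f (\<gamma> \<circ> \<rho>))"
    by (rule sum.reindex_bij_betw[OF bij_betw_stabilizer_coset[OF \<rho>], symmetric])
  also have "\<dots> = (\<Sum>\<gamma>\<in>stabilizer w. fsign ?n ?J \<rho> *
      (fsign ?n ?J \<gamma> * fsign ?n I \<gamma> * fsign ?n (pull ?n \<gamma> I) \<rho>))"
  proof (rule sum.cong[OF refl])
    fix \<gamma> assume \<gamma>: "\<gamma> \<in> stabilizer w"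
    then have g: "\<gamma> permutes {..<?n}" by (simp add: stabilizer_def)
    show "?f (\<gamma> \<circ> \<rho>) = fsign ?n ?J \<rho> *
      (fsign ?n ?J \<gamma> * fsign ?n I \<gamma> * fsign ?n (pull ?n \<gamma> I) \<rho>)"
      using fsign_compose[OF g \<rho> odd_positions_subset, where 'f = 'f] pull_odd_positions[OF \<gamma>]
        fsign_compose[OF g \<rho> I, where 'f = 'f] by (simp add: mult_ac)
  qed
  finally show ?thesis by (simp add: sum_distrib_left)
qed

lemma card_pull:
  assumes "\<gamma> permutes {..<n}" "D \<subseteq> {..<n}"
  shows "card (pull n \<gamma> D) = card D"
proof -
  have "\<gamma> ` pull n \<gamma> D = D"
  proof
    show "D \<subseteq> \<gamma> ` pull n \<gamma> D"
    proof
      fix i assume i: "i \<in> D"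
      then have "i \<in> \<gamma> ` {..<n}" using assms(2) permutes_image[OF assms(1)] by auto
      then show "i \<in> \<gamma> ` pull n \<gamma> D" using i by auto
    qed
  qed auto
  moreover have "inj_on \<gamma> (pull n \<gamma> D)" using permutes_inj_on[OF assms(1)] .
  ultimately show ?thesis using card_image by metis
qed

lemma finite_letter_sets: "finite (letter_sets w)"
  by (rule finite_subset[of _ "Pow (set w)"]) (auto simp: letter_sets_def)

text \<open>
  Evaluated at the rearrangements \<open>w\<rho>\<close>, a relation between the functionals becomes a relation
  \<open>\<Sum>\<^sub>I \<mu>\<^sub>I f\<^sub>I(\<rho>) = 0\<close> over even sets, so all \<open>\<mu>\<^sub>I\<close> vanish. The stabilizer does not change the letters
  at the positions of \<open>D\<close>, so for the set \<open>I\<close> that belongs to \<open>R\<close> only the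
  coefficient \<open>c R\<close> enters \<open>\<mu>\<^sub>I\<close>. It enters with a positive multiplicity, since all stabilizer elements
  that fix this set contribute the sign \<open>1\<close>.
\<close>

lemma sign_functionals_independent:
  fixes c :: "gen set \<Rightarrow> 'f::field_char_0"
  assumes zero: "\<And>v. v \<in> content_space w \<Longrightarrow>
      (\<Sum>S\<in>letter_sets w. c S * sign_functional w (twist w (representatives w S)) v) = 0"
    and R: "R \<in> letter_sets w"
  shows "c R = 0"
proof -
  let ?n = "length w" and ?J = "odd_positions w" and ?N = "letter_sets w"
  let ?I = "\<lambda>S. twist w (representatives w S)"
  let ?E = "{I. I \<subseteq> {..<?n} \<and> even (card I)}"
  let ?h = "\<lambda>(S, \<gamma>). c S * (fsign ?n ?J \<gamma> * fsign ?n (?I S) \<gamma>)"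
  let ?g = "\<lambda>(S, \<gamma>). pull ?n \<gamma> (?I S)"
  let ?A = "?N \<times> stabilizer w"
  define \<mu> where "\<mu> I = sum ?h {x \<in> ?A. ?g x = I}" for I
  have rep: "S \<in> ?N \<Longrightarrow> S \<subseteq> set w" for S by (simp add: letter_sets_def)
  have Isub: "?I S \<subseteq> {..<?n}" if "S \<in> ?N" for S
    using representatives(1)[OF rep[OF that]] by (rule twist_subset)
  have finA: "finite ?A" using finite_letter_sets finite_stabilizer by blast
  have gE: "?g ` ?A \<subseteq> ?E"
  proof
    fix I assume "I \<in> ?g ` ?A"
    then obtain S \<gamma> where S: "S \<in> ?N" and \<gamma>: "\<gamma> \<in> stabilizer w"
      and I: "I = pull ?n \<gamma> (?I S)" by auto
    have "card I = card (?I S)"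
      unfolding I by (rule card_pull) (use \<gamma> Isub[OF S] in \<open>auto simp: stabilizer_def\<close>)
    moreover have "even (card (?I S))"
      using S even_card_twist[OF representatives(1)[OF rep[OF S]]] representatives(4)[OF rep[OF S]]
      by (simp add: letter_sets_def)
    ultimately show "I \<in> ?E" using I by auto
  qed
  have "\<mu> I = 0" if "I \<in> ?E" for I
  proof (rule even_fsigns_independent[where c = \<mu>])
    fix \<rho> assume \<rho>: "\<rho> permutes {..<?n}"
    let ?v = "Poly_Mapping.single (permute_list \<rho> w) (1 :: 'f)"
    have "(\<Sum>I\<in>?E. \<mu> I * fsign ?n I \<rho>) =
        (\<Sum>I\<in>?E. sum (\<lambda>x. ?h x * fsign ?n (?g x) \<rho>) {x \<in> ?A. ?g x = I})"
      unfolding \<mu>_def sum_distrib_right by (intro sum.cong) auto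
    also have "\<dots> = (\<Sum>x\<in>?A. ?h x * fsign ?n (?g x) \<rho>)"
      by (rule sum.group[OF finA _ gE]) simp
    also have "\<dots> = (\<Sum>S\<in>?N. \<Sum>\<gamma>\<in>stabilizer w. c S *
        (fsign ?n ?J \<gamma> * fsign ?n (?I S) \<gamma> * fsign ?n (pull ?n \<gamma> (?I S)) \<rho>))"
      unfolding sum.cartesian_product by (rule sum.cong) (auto simp: mult_ac)
    finally have "fsign ?n ?J \<rho> * (\<Sum>I\<in>?E. \<mu> I * fsign ?n I \<rho>) =
        (\<Sum>S\<in>?N. c S * sign_functional w (?I S) ?v)"
      using sign_functional_single[OF \<rho> Isub, where 'f = 'f]
      by (simp add: sum_distrib_left mult_ac)
    also have "\<dots> = 0" using zero single_content_space mset_permute_list[OF \<rho>] by blast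
    finally show "(\<Sum>I\<in>?E. \<mu> I * fsign ?n I \<rho>) = 0"
      using fsign_square[OF \<rho> odd_positions_subset, where 'f = 'f] by auto
  qed (use that in auto)
  moreover have "?I R \<in> ?E"
  proof -
    have "pull ?n id (?I R) = ?I R" using Isub[OF R] by auto
    then have "?I R \<in> ?g ` ?A"
      using R id_in_stabilizer[of w] by (intro image_eqI[of _ _ "(R, id)"]) auto
    then show ?thesis using gE by blast
  qed
  ultimately have "\<mu> (?I R) = 0" by blast
  moreover have "{x \<in> ?A. ?g x = ?I R} = {R} \<times> {\<gamma> \<in> stabilizer w. pull ?n \<gamma> (?I R) = ?I R}"
  proof -
    have "S = R" if S: "S \<in> ?N" and \<gamma>: "\<gamma> \<in> stabilizer w" and eq: "pull ?n \<gamma> (?I S) = ?I R" for S \<gamma>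
    proof -
      have g: "\<gamma> permutes {..<?n}" using \<gamma> by (simp add: stabilizer_def)
      note rS = representatives[OF rep[OF S]] and rR = representatives[OF rep[OF R]]
      have "twist w (pull ?n \<gamma> (representatives w S)) = twist w (representatives w R)"
        using eq pull_twist[OF \<gamma>] by simp
      then have pe: "pull ?n \<gamma> (representatives w S) = representatives w R"
        by (metis twist_twist)
      have "(!) w ` pull ?n \<gamma> (representatives w S) = (!) w ` representatives w S"
      proof (intro set_eqI iffI)
        fix x assume "x \<in> (!) w ` pull ?n \<gamma> (representatives w S)"
        then obtain i where "i < ?n" "\<gamma> i \<in> representatives w S" "x = w ! i" by auto
        moreover from this have "x = w ! \<gamma> i" using stabilizer_nth[OF \<gamma>] by simp
        ultimately show "x \<in> (!) w ` representatives w S" by blast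
      next
        fix g assume "g \<in> (!) w ` representatives w S"
        then obtain i where i: "i \<in> representatives w S" "g = w ! i" by auto
        then have "i \<in> \<gamma> ` {..<?n}" using rS(1) permutes_image[OF g] by auto
        then obtain j where j: "j < ?n" "i = \<gamma> j" by auto
        then show "g \<in> (!) w ` pull ?n \<gamma> (representatives w S)"
          using i stabilizer_nth[OF \<gamma>, of j] by auto
      qed
      then show "S = R" using rS(3) rR(3) pe by simp
    qed
    then show ?thesis using R by auto
  qed
  ultimately have "0 = (\<Sum>\<gamma> | \<gamma> \<in> stabilizer w \<and> pull ?n \<gamma> (?I R) = ?I R.
      c R * (fsign ?n ?J \<gamma> * fsign ?n (?I R) \<gamma>))"
    by (simp add: \<mu>_def flip: sum.cartesian_product)
  also have "\<dots> = (\<Sum>\<gamma> | \<gamma> \<in> stabilizer w \<and> pull ?n \<gamma> (?I R) = ?I R. c R)"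
  proof (rule sum.cong[OF refl])
    fix \<gamma> assume "\<gamma> \<in> {\<gamma>. \<gamma> \<in> stabilizer w \<and> pull ?n \<gamma> (?I R) = ?I R}"
    then have \<gamma>: "\<gamma> \<in> stabilizer w" "pull ?n \<gamma> (?I R) = ?I R" by auto
    have "pull ?n \<gamma> (representatives w R) = representatives w R"
      using \<gamma> pull_twist[OF \<gamma>(1)] by (metis twist_twist)
    from fsign_stabilizer_invariant[OF \<gamma>(1) representatives(1,2)[OF rep[OF R]] this, where 'f = 'f]
    show "c R * (fsign ?n ?J \<gamma> * fsign ?n (?I R) \<gamma>) = c R" by simp
  qed
  also have "\<dots> = of_nat (card {\<gamma> \<in> stabilizer w. pull ?n \<gamma> (?I R) = ?I R}) * c R" by simp
  finally have "card {\<gamma> \<in> stabilizer w. pull ?n \<gamma> (?I R) = ?I R} = 0 \<or> c R = 0" by simp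
  moreover have "id \<in> {\<gamma> \<in> stabilizer w. pull ?n \<gamma> (?I R) = ?I R}"
    using id_in_stabilizer Isub[OF R] by auto
  ultimately show ?thesis using finite_stabilizer[of w] by (auto simp: card_eq_0_iff)
qed

lemma content_space_finite_dim:
  obtains F where "finite F" "content_space w \<subseteq> pm.span (F :: (gen list \<Rightarrow>\<^sub>0 'f::field) set)"
proof
  let ?F = "(\<lambda>u. Poly_Mapping.single u (1 :: 'f)) ` {u. mset u = mset w}"
  have "finite {u. mset u = mset w}" using mset_eq_finite[of w] by (simp add: eq_commute)
  then show "finite ?F" by simp
  show "content_space w \<subseteq> pm.span ?F"
  proof
    fix v :: "gen list \<Rightarrow>\<^sub>0 'f" assume v: "v \<in> content_space w"
    have "v = (\<Sum>u\<in>Poly_Mapping.keys v. pscale (Poly_Mapping.lookup v u) (Poly_Mapping.single u 1))"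
      by (rule poly_mapping_eqI)
        (simp add: lookup_sum lookup_single when_def in_keys_iff if_distrib[where f = "(*) _"] cong: if_cong)
    also have "\<dots> \<in> pm.span ?F"
      using v by (intro pm.span_sum pm.span_scale pm.span_base) (auto simp: content_space_def)
    finally show "v \<in> pm.span ?F" .
  qed
qed

lemma quotient_dim_content_space:
  "quotient_dim (content_space w :: (gen list \<Rightarrow>\<^sub>0 'f::field_char_0) set)
    (pm.span {poly_act (length w) v q | v q.
      v \<in> content_space w \<and> q \<in> multilinear_identities (gscale :: 'f \<Rightarrow> _) (length w)}) =
    card (letter_sets w)"
proof -
  let ?V = "content_space w :: (gen list \<Rightarrow>\<^sub>0 'f) set"
  let ?\<phi> = "\<lambda>S. sign_functional w (twist w (representatives w S)) :: (gen list \<Rightarrow>\<^sub>0 'f) \<Rightarrow> 'f"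
  obtain F where F: "finite F" "?V \<subseteq> pm.span F" by (rule content_space_finite_dim)
  have "(\<forall>I\<subseteq>{..<length w}. sign_functional w I v = 0) \<longleftrightarrow> (\<forall>S\<in>letter_sets w. ?\<phi> S v = 0)" for v
  proof
    assume "\<forall>S\<in>letter_sets w. ?\<phi> S v = 0"
    then show "\<forall>I\<subseteq>{..<length w}. sign_functional w I v = 0"
      using sign_functionals_vanish by blast
  next
    assume "\<forall>I\<subseteq>{..<length w}. sign_functional w I v = 0"
    then show "\<forall>S\<in>letter_sets w. ?\<phi> S v = 0"
      using twist_subset[OF representatives(1)] by (auto simp: letter_sets_def)
  qed
  then have "pm.span {poly_act (length w) v q | v q.
      v \<in> content_space w \<and> q \<in> multilinear_identities (gscale :: 'f \<Rightarrow> _) (length w)} =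
      {v \<in> ?V. \<forall>S\<in>letter_sets w. ?\<phi> S v = 0}"
    by (simp add: span_poly_act_identities)
  moreover have "quotient_dim ?V {v \<in> ?V. \<forall>S\<in>letter_sets w. ?\<phi> S v = 0} = card (letter_sets w)"
    by (rule quotient_dim_eq_card[OF subspace_content_space F sign_functional_add
          sign_functional_scale finite_letter_sets])
      (use sign_functionals_independent in blast)
  ultimately show ?thesis by simp
qed

text \<open>
  For a fixed \<open>x\<close> in \<open>A\<close>, every subset of \<open>A - {x}\<close> has the right parity either with or without \<open>x\<close> added.
\<close>

lemma card_subsets_of_parity:
  assumes "finite A" "A \<noteq> {}"
  shows "card {S. S \<subseteq> A \<and> even (card S + c)} = 2 ^ (card A - 1)"
proof -
  obtain x where x: "x \<in> A" using assms(2) by auto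
  let ?f = "\<lambda>S. if even (card S + c) then S else insert x S"
  have fin: "finite S" if "S \<subseteq> A" for S using that assms(1) finite_subset by blast
  have "bij_betw ?f (Pow (A - {x})) {S. S \<subseteq> A \<and> even (card S + c)}"
  proof (rule bij_betw_byWitness[where f' = "\<lambda>S. S - {x}"])
    show "\<forall>S\<in>Pow (A - {x}). ?f S - {x} = S" by auto
    show "\<forall>S\<in>{S. S \<subseteq> A \<and> even (card S + c)}. ?f (S - {x}) = S"
    proof
      fix S assume S: "S \<in> {S. S \<subseteq> A \<and> even (card S + c)}"
      then have "finite S" using fin by blast
      show "?f (S - {x}) = S"
      proof (cases "x \<in> S")
        case True
        have "card S = Suc (card (S - {x}))" using \<open>finite S\<close> True by (rule card.remove)
        then show ?thesis using S True by (auto simp: insert_absorb)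
      qed (use S in simp)
    qed
    show "?f ` Pow (A - {x}) \<subseteq> {S. S \<subseteq> A \<and> even (card S + c)}"
    proof
      fix R assume "R \<in> ?f ` Pow (A - {x})"
      then obtain S where S: "S \<subseteq> A - {x}" "R = ?f S" by (elim imageE) blast
      have "finite S" by (rule fin) (use S(1) in blast)
      moreover have "x \<notin> S" using S(1) by auto
      ultimately show "R \<in> {S. S \<subseteq> A \<and> even (card S + c)}" using S x by auto
    qed
    show "(\<lambda>S. S - {x}) ` {S. S \<subseteq> A \<and> even (card S + c)} \<subseteq> Pow (A - {x})" by auto
  qed
  then have "card {S. S \<subseteq> A \<and> even (card S + c)} = card (Pow (A - {x}))"
    by (simp add: bij_betw_same_card)
  then show ?thesis using assms x by (simp add: card_Pow)
qed

lemma card_letter_sets: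
  "card (letter_sets w) = (if set w = {} then 1 else 2 ^ (card (set w) - 1))"
proof (cases "set w = {}")
  case True
  then have "letter_sets w = {{}}" by (auto simp: letter_sets_def odd_positions_def)
  then show ?thesis using True by simp
qed (simp add: letter_sets_def card_subsets_of_parity del: even_add)

definition sorted_word :: "nat \<Rightarrow> nat \<Rightarrow> (nat \<Rightarrow> nat) \<Rightarrow> (nat \<Rightarrow> nat) \<Rightarrow> gen list" where
  "sorted_word k l a b =
     concat (map (\<lambda>i. replicate (a i) (X i)) [0..<k]) @ concat (map (\<lambda>j. replicate (b j) (Z j)) [0..<l])"

lemma count_list_blocks:
  assumes "inj f"
  shows "count_list (concat (map (\<lambda>i. replicate (a i) (f i)) [0..<k])) (f i) = (if i < k then a i else 0)"
proof (induction k)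
  case (Suc k)
  have "count_list (replicate (a k) (f k)) (f i) = (if i = k then a i else 0)"
    using assms by (auto simp: inj_eq count_mset[symmetric])
  then show ?case using Suc by auto
qed simp

lemma sorted_word:
  "count_list (sorted_word k l a b) (X i) = (if i < k then a i else 0)"
  "count_list (sorted_word k l a b) (Z j) = (if j < l then b j else 0)"
  "length (sorted_word k l a b) = (\<Sum>i<k. a i) + (\<Sum>j<l. b j)"
proof -
  have "count_list (concat (map (\<lambda>j. replicate (b j) (Z j)) [0..<l])) (X i) = 0"
    "count_list (concat (map (\<lambda>i. replicate (a i) (X i)) [0..<k])) (Z j) = 0"
    by (auto simp: count_list_0_iff)
  then show "count_list (sorted_word k l a b) (X i) = (if i < k then a i else 0)"
    "count_list (sorted_word k l a b) (Z j) = (if j < l then b j else 0)"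
    by (simp_all add: sorted_word_def count_list_blocks inj_def)
  show "length (sorted_word k l a b) = (\<Sum>i<k. a i) + (\<Sum>j<l. b j)"
    by (simp add: sorted_word_def length_concat comp_def interv_sum_list_conv_sum_set_nat atLeast0LessThan)
qed

lemma homogeneous_part_eq_content_space:
  "homogeneous_part k l a b = (content_space (sorted_word k l a b) :: (gen list \<Rightarrow>\<^sub>0 'f::field) set)"
proof -
  let ?w = "sorted_word k l a b"
  let ?C = "\<lambda>u. (length u = (\<Sum>i<k. a i) + (\<Sum>j<l. b j) \<and> set u \<subseteq> gens k l) \<and>
      (\<forall>i<k. count_list u (X i) = a i) \<and> (\<forall>j<l. count_list u (Z j) = b j)"
  have content: "?C u \<longleftrightarrow> mset u = mset ?w" (is "?L \<longleftrightarrow> ?R") for u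
  proof
    assume ?L
    have "count_list u g = count_list ?w g" for g
    proof (cases g)
      case (X i)
      have "count_list u (X i) = 0" if "\<not> i < k"
        using \<open>?L\<close> that by (auto simp: count_list_0_iff gens_def)
      then show ?thesis using \<open>?L\<close> X by (auto simp: sorted_word(1))
    next
      case (Z j)
      have "count_list u (Z j) = 0" if "\<not> j < l"
        using \<open>?L\<close> that by (auto simp: count_list_0_iff gens_def)
      then show ?thesis using \<open>?L\<close> Z by (auto simp: sorted_word(2))
    qed
    then show ?R by (simp add: multiset_eq_iff count_mset)
  next
    assume R: ?R
    have c: "count_list u g = count_list ?w g" for g using R by (metis count_mset)
    have "length u = length ?w" "set u = set ?w" using R by (auto dest: mset_eq_length mset_eq_setD)
    then show ?L using c sorted_word(1,2)[of k l a b] sorted_word(3)[of k l a b]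
      by (auto simp: sorted_word_def gens_def)
  qed
  show ?thesis
    unfolding homogeneous_part_def content_space_def tensor_power_def content[symmetric]
    by (simp only: ball_conj_distrib mem_Collect_eq)
qed

lemma homogeneous_dim_grassmann:
  "homogeneous_dim (gscale :: 'f::field_char_0 \<Rightarrow> _) k l a b =
    (let s = card {i. i < k \<and> a i \<noteq> 0} + card {j. j < l \<and> b j \<noteq> 0} in if s = 0 then 1 else 2 ^ (s - 1))"
proof -
  let ?w = "sorted_word k l a b"
  have "homogeneous_dim (gscale :: 'f \<Rightarrow> _) k l a b = card (letter_sets ?w)"
    using quotient_dim_content_space[of ?w, where 'f = 'f]
    by (simp add: homogeneous_dim_def homogeneous_part_eq_content_space sorted_word(3) Let_def)
  moreover have "set ?w = X ` {i. i < k \<and> a i \<noteq> 0} \<union> Z ` {j. j < l \<and> b j \<noteq> 0}"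
    by (auto simp: sorted_word_def)
  then have "card (set ?w) = card {i. i < k \<and> a i \<noteq> 0} + card {j. j < l \<and> b j \<noteq> 0}"
    by (simp only:, subst card_Un_disjoint) (auto simp: card_image inj_on_def)
  moreover have "set ?w = {} \<longleftrightarrow> card (set ?w) = 0" by simp
  ultimately show ?thesis by (simp only: card_letter_sets Let_def)
qed

section \<open>The product of the series \<open>(1 + t) / (1 - t)\<close>\<close>

lemma mfps_eqI: "(\<And>m. mfps_coeff f m = mfps_coeff g m) \<Longrightarrow> f = g"
  by (simp add: mfps_coeff_inject[symmetric] fun_eq_iff)

lemma mfps_coeff_var_mult:
  fixes f :: "('v, 'a::comm_ring_1) mfps"
  shows "mfps_coeff (mfps_var v * f) m =
    (if Poly_Mapping.lookup m v = 0 then 0 else mfps_coeff f (m - Poly_Mapping.single v 1))"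
proof -
  let ?s = "Poly_Mapping.single v (1 :: nat)"
  have s: "?s + q = m \<longleftrightarrow> Poly_Mapping.lookup m v \<noteq> 0 \<and> q = m - ?s" for q
  proof
    assume "?s + q = m"
    then show "Poly_Mapping.lookup m v \<noteq> 0 \<and> q = m - ?s" by (auto simp: lookup_add)
  next
    assume "Poly_Mapping.lookup m v \<noteq> 0 \<and> q = m - ?s"
    then show "?s + q = m"
      by (intro poly_mapping_eqI) (auto simp: lookup_add lookup_minus lookup_single when_def)
  qed
  have "mfps_coeff (mfps_var v * f) m =
      (\<Sum>(p, q) | p + q = m. (if p = ?s then 1 else 0) * mfps_coeff f q)"
    by (simp add: times_mfps.rep_eq mfps_var.rep_eq)
  also have "\<dots> = (\<Sum>x\<in>(if Poly_Mapping.lookup m v = 0 then {} else {(?s, m - ?s)}).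
      (case x of (p, q) \<Rightarrow> (if p = ?s then 1 else 0) * mfps_coeff f q))"
    by (rule sum.mono_neutral_right[OF finite_exponent_splits]) (auto simp: s simp del: One_nat_def split: if_splits)
  also have "\<dots> = (if Poly_Mapping.lookup m v = 0 then 0 else mfps_coeff f (m - ?s))" by simp
  finally show ?thesis .
qed

text \<open>For finite \<open>A\<close> this is the product of the series \<open>(1 + t) / (1 - t)\<close> with \<open>t\<close> in \<open>A\<close>.\<close>

definition support_series :: "'v set \<Rightarrow> ('v, rat) mfps" where
  "support_series A =
     Abs_mfps (\<lambda>m. if Poly_Mapping.keys m \<subseteq> A then 2 ^ card (Poly_Mapping.keys m) else 0)"

lemma mfps_coeff_support_series:
  "mfps_coeff (support_series A) m =
    (if Poly_Mapping.keys m \<subseteq> A then 2 ^ card (Poly_Mapping.keys m) else 0)"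
  by (simp add: support_series_def Abs_mfps_inverse)

lemma support_series_singleton:
  "(1 + mfps_var v) / (1 - mfps_var v) = (support_series {v} :: ('v, rat) mfps)"
proof -
  \<comment> \<open>the geometric series \<open>1 / (1 - v)\<close>\<close>
  define g :: "('v, rat) mfps" where
    "g = Abs_mfps (\<lambda>m. if Poly_Mapping.keys m \<subseteq> {v} then 1 else 0)"
  have g: "mfps_coeff g m = (if Poly_Mapping.keys m \<subseteq> {v} then 1 else 0)" for m
    by (simp add: g_def Abs_mfps_inverse)
  have keys: "Poly_Mapping.keys (m - Poly_Mapping.single v 1) \<subseteq> {v} \<longleftrightarrow> Poly_Mapping.keys m \<subseteq> {v}" for m
    by (auto simp: in_keys_iff lookup_minus lookup_single when_def subset_iff)
  have empty: "m = 0" if "Poly_Mapping.keys m \<subseteq> {v}" "Poly_Mapping.lookup m v = 0"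
    for m :: "'v \<Rightarrow>\<^sub>0 nat"
    using that by (intro poly_mapping_eqI) (auto simp: in_keys_iff subset_iff)
  have full: "Poly_Mapping.keys m = {v}" if "Poly_Mapping.keys m \<subseteq> {v}" "Poly_Mapping.lookup m v \<noteq> 0"
    for m :: "'v \<Rightarrow>\<^sub>0 nat"
    using that by (auto simp: in_keys_iff)
  have "(1 - mfps_var v) * g = 1"
  proof (rule mfps_eqI)
    fix m
    show "mfps_coeff ((1 - mfps_var v) * g) m = mfps_coeff 1 m"
      using empty[of m] by (auto simp: left_diff_distrib minus_mfps.rep_eq mfps_coeff_var_mult g keys
          one_mfps.rep_eq simp del: One_nat_def)
  qed
  then have "inverse (1 - mfps_var v) = g" by (rule inverse_mfps_unique)
  moreover have "(1 + mfps_var v) * g = support_series {v}"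
  proof (rule mfps_eqI)
    fix m
    show "mfps_coeff ((1 + mfps_var v) * g) m = mfps_coeff (support_series {v}) m"
      using empty[of m] full[of m]
      by (auto simp: distrib_right plus_mfps.rep_eq mfps_coeff_var_mult g keys mfps_coeff_support_series
          simp del: One_nat_def)
  qed
  ultimately show ?thesis by (simp add: divide_mfps_def)
qed

text \<open>
  A monomial in the variables from \<open>A \<union> B\<close> splits in exactly one way into a monomial over \<open>A\<close> and
  one over \<open>B\<close>, and the numbers of occurring variables add up.
\<close>

lemma support_series_mult:
  fixes A B :: "'v set"
  assumes disj: "A \<inter> B = {}"
  shows "support_series A * support_series B = support_series (A \<union> B)"
proof (rule mfps_eqI)
  fix m :: "'v \<Rightarrow>\<^sub>0 nat"
  let ?K = "Poly_Mapping.keys m"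
  let ?c = "\<lambda>A p. if Poly_Mapping.keys p \<subseteq> A then 2 ^ card (Poly_Mapping.keys p) else 0 :: rat"
  \<comment> \<open>the part of the monomial \<open>m\<close> in the variables from \<open>C\<close>\<close>
  define r where "r C = (\<Sum>v\<in>?K \<inter> C. Poly_Mapping.single v (Poly_Mapping.lookup m v))" for C
  have lr: "Poly_Mapping.lookup (r C) v = (if v \<in> C then Poly_Mapping.lookup m v else 0)" for C v
    by (auto simp: r_def lookup_sum lookup_single when_def in_keys_iff)
  have kr: "Poly_Mapping.keys (r C) = ?K \<inter> C" for C by (auto simp: in_keys_iff lr split: if_splits)
  have uniq: "p = r A \<and> q = r B" if pq: "p + q = m" "Poly_Mapping.keys p \<subseteq> A" "Poly_Mapping.keys q \<subseteq> B"
    for p q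
  proof -
    have p0: "Poly_Mapping.lookup p v = 0" if "v \<notin> A" for v using pq(2) that by (auto simp: in_keys_iff)
    have q0: "Poly_Mapping.lookup q v = 0" if "v \<notin> B" for v using pq(3) that by (auto simp: in_keys_iff)
    have m: "Poly_Mapping.lookup m v = Poly_Mapping.lookup p v + Poly_Mapping.lookup q v" for v
      using pq(1) by (auto simp: lookup_add)
    have "Poly_Mapping.lookup q v = 0" if "v \<in> A" for v using q0 disj that by blast
    moreover have "Poly_Mapping.lookup p v = 0" if "v \<in> B" for v using p0 disj that by blast
    ultimately show ?thesis
      using p0 q0 by (auto intro!: poly_mapping_eqI simp: lr m)
  qed
  have sum: "r A + r B = m \<longleftrightarrow> ?K \<subseteq> A \<union> B"
  proof
    assume "r A + r B = m"
    then have "?K = Poly_Mapping.keys (r A + r B)" by simp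
    also have "\<dots> \<subseteq> A \<union> B" using keys_add[of "r A" "r B"] by (auto simp: kr)
    finally show "?K \<subseteq> A \<union> B" .
  next
    assume "?K \<subseteq> A \<union> B"
    then show "r A + r B = m"
      using disj by (intro poly_mapping_eqI) (auto simp: lookup_add lr in_keys_iff subset_iff)
  qed
  have "mfps_coeff (support_series A * support_series B) m = (\<Sum>(p, q) | p + q = m. ?c A p * ?c B q)"
    by (simp add: times_mfps.rep_eq mfps_coeff_support_series)
  also have "\<dots> = (\<Sum>x\<in>(if ?K \<subseteq> A \<union> B then {(r A, r B)} else {}). (case x of (p, q) \<Rightarrow> ?c A p * ?c B q))"
  proof (rule sum.mono_neutral_right[OF finite_exponent_splits])
    show "(if ?K \<subseteq> A \<union> B then {(r A, r B)} else {}) \<subseteq> {(p, q). p + q = m}" using sum by auto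
    show "\<forall>x\<in>{(p, q). p + q = m} - (if ?K \<subseteq> A \<union> B then {(r A, r B)} else {}).
        (case x of (p, q) \<Rightarrow> ?c A p * ?c B q) = 0"
      using uniq sum by (auto split: if_splits)
  qed
  also have "\<dots> = (if ?K \<subseteq> A \<union> B then 2 ^ card (?K \<inter> A) * 2 ^ card (?K \<inter> B) else 0)"
    by (simp add: kr)
  also have "\<dots> = mfps_coeff (support_series (A \<union> B)) m"
  proof (cases "?K \<subseteq> A \<union> B")
    case True
    have "card ?K = card ((?K \<inter> A) \<union> (?K \<inter> B))" using True by (intro arg_cong[where f = card]) auto
    also have "\<dots> = card (?K \<inter> A) + card (?K \<inter> B)" using disj by (intro card_Un_disjoint) auto
    finally show ?thesis using True by (simp add: mfps_coeff_support_series power_add)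
  qed (simp add: mfps_coeff_support_series)
  finally show "mfps_coeff (support_series A * support_series B) m = mfps_coeff (support_series (A \<union> B)) m" .
qed

lemma prod_eq_support_series:
  assumes "inj f"
  shows "(\<Prod>i<k. (1 + mfps_var (f i)) / (1 - mfps_var (f i))) = support_series (f ` {..<k :: nat})"
proof (induction k)
  case 0
  have "support_series {} = (1 :: ('v, rat) mfps)"
    by (rule mfps_eqI) (auto simp: mfps_coeff_support_series one_mfps.rep_eq)
  then show ?case by simp
next
  case (Suc k)
  have "f ` {..<k} \<inter> {f k} = {}" using assms by (auto simp: inj_eq)
  then show ?case
    using Suc by (simp add: support_series_singleton support_series_mult lessThan_Suc)
qed

lemma mfps_half:
  fixes f :: "('v, rat) mfps"
  shows "mfps_coeff ((1 / 2) * f) m = 1 / 2 * mfps_coeff f m"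
proof -
  \<comment> \<open>the constant series \<open>1 / 2\<close>\<close>
  define h :: "('v, rat) mfps" where "h = Abs_mfps (\<lambda>m. if m = 0 then 1 / 2 else 0)"
  have "2 * h = h + h" by (rule mult_2)
  also have "\<dots> = 1"
    by (rule mfps_eqI)
      (simp only: plus_mfps.rep_eq one_mfps.rep_eq h_def Abs_mfps_inverse[OF UNIV_I], simp)
  finally have "inverse 2 = h" by (rule inverse_mfps_unique)
  then have "mfps_coeff ((1 / 2) * f) m = mfps_coeff (h * f) m" by (simp add: divide_mfps_def)
  moreover have "f = h * f + h * f"
    using \<open>h + h = 1\<close> by (metis distrib_right mult_1)
  then have "mfps_coeff f m = mfps_coeff (h * f) m + mfps_coeff (h * f) m"
    using plus_mfps.rep_eq[of "h * f" "h * f"] by simp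
  ultimately show ?thesis by simp
qed

theorem proposition7p2:
  fixes k l :: nat
  shows "double_hilbert_series (gscale :: 'f::field_char_0 \<Rightarrow> 'f grassmann \<Rightarrow> 'f grassmann) k l =
    (1 / 2) * (1 + (\<Prod>i<k. (1 + mfps_var (T i)) / (1 - mfps_var (T i))) *
                   (\<Prod>j<l. (1 + mfps_var (Y j)) / (1 - mfps_var (Y j))))"
proof (rule mfps_eqI)
  fix m :: "hvar \<Rightarrow>\<^sub>0 nat"
  let ?K = "Poly_Mapping.keys m"
  let ?a = "\<lambda>i. Poly_Mapping.lookup m (T i)" and ?b = "\<lambda>j. Poly_Mapping.lookup m (Y j)"
  have "(\<Prod>i<k. (1 + mfps_var (T i)) / (1 - mfps_var (T i))) *
      (\<Prod>j<l. (1 + mfps_var (Y j)) / (1 - mfps_var (Y j))) = support_series (hvars k l)"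
    by (subst (1 2) prod_eq_support_series, use support_series_mult[of "T ` {..<k}" "Y ` {..<l}"] in
        \<open>auto simp: inj_def hvars_def\<close>)
  then have rhs: "mfps_coeff ((1 / 2) * (1 + (\<Prod>i<k. (1 + mfps_var (T i)) / (1 - mfps_var (T i))) *
      (\<Prod>j<l. (1 + mfps_var (Y j)) / (1 - mfps_var (Y j))))) m =
    (1 / 2 * ((if m = 0 then 1 else 0) + (if ?K \<subseteq> hvars k l then 2 ^ card ?K else 0)) :: rat)"
    by (simp add: mfps_half plus_mfps.rep_eq one_mfps.rep_eq mfps_coeff_support_series)
  have card: "card {i. i < k \<and> ?a i \<noteq> 0} + card {j. j < l \<and> ?b j \<noteq> 0} = card ?K"
    if "?K \<subseteq> hvars k l"
  proof -
    have "?K = T ` {i. i < k \<and> ?a i \<noteq> 0} \<union> Y ` {j. j < l \<and> ?b j \<noteq> 0}"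
    proof (rule set_eqI)
      fix x show "x \<in> ?K \<longleftrightarrow> x \<in> T ` {i. i < k \<and> ?a i \<noteq> 0} \<union> Y ` {j. j < l \<and> ?b j \<noteq> 0}"
      proof -
        have "x \<in> ?K \<longrightarrow> x \<in> hvars k l" using that by blast
        then show ?thesis by (cases x) (auto simp: hvars_def in_keys_iff)
      qed
    qed
    then have "card ?K = card (T ` {i. i < k \<and> ?a i \<noteq> 0} \<union> Y ` {j. j < l \<and> ?b j \<noteq> 0})"
      by simp
    also have "\<dots> = card {i. i < k \<and> ?a i \<noteq> 0} + card {j. j < l \<and> ?b j \<noteq> 0}"
      by (subst card_Un_disjoint) (auto simp: card_image inj_on_def)
    finally show ?thesis by simp
  qed
  have "mfps_coeff (double_hilbert_series (gscale :: 'f \<Rightarrow> _) k l) m =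
      (if ?K \<subseteq> hvars k l then if card ?K = 0 then 1 else 2 ^ (card ?K - 1) else 0)"
    using card by (simp add: double_hilbert_series_def Abs_mfps_inverse homogeneous_dim_grassmann Let_def)
  also have "\<dots> = 1 / 2 * ((if m = 0 then 1 else 0) + (if ?K \<subseteq> hvars k l then 2 ^ card ?K else 0))"
  proof (cases "m = 0")
    case False
    then obtain c where "card ?K = Suc c" by (cases "card ?K") auto
    then show ?thesis using False by simp
  qed simp
  finally show "mfps_coeff (double_hilbert_series (gscale :: 'f \<Rightarrow> 'f grassmann \<Rightarrow> 'f grassmann) k l) m =
      mfps_coeff ((1 / 2) * (1 + (\<Prod>i<k. (1 + mfps_var (T i)) / (1 - mfps_var (T i))) *
      (\<Prod>j<l. (1 + mfps_var (Y j)) / (1 - mfps_var (Y j))))) m"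
    by (simp only: rhs)
qed

end
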